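(* Let $n$ be a prime number. Let $A=\{z\in\mathbb{C}: r<|z|<R\}$, $0\le r<1<R\le\infty$, be an annulus of conformal module $m(A)>\frac{2\pi}{\log 2}\,n$, and let $f$ be a separable algebroid function on $A$ of degree $n$ such that the index of its discriminant is divisible by $n$. Then $f$ is reducible.
   Context: The conformal module of a round annulus $A=\{r<|z|<R\}$, $0\le r<R\le\infty$, is $m(A)=\frac{1}{2\pi}\log\frac{R}{r}\in(0,\infty]$. A quasipolynomial of degree $n$ on a topological space $X$ is a function $f(x,\zeta)=a_0(x)+a_1(x)\zeta+\dots+a_{n-1}(x)\zeta^{n-1}+\zeta^n$, $x\in X$, $\zeta\in\mathbb{C}$, with continuous coefficients $a_j:X\to\mathbb{C}$ (i.e. a continuous map from $X$ to the monic polynomials of degree $n$). It is separable if for every $x$ the polynomial $f_x=f(x,\cdot)$ has no multiple zeros. If $X$ is a complex manifold and the $a_j$ are holomorphic, $f$ is called an algebroid function. A separable quasipolynomial is irreducible if it cannot be written as a product of two quasipolynomials (on all of $X$) of positive degree, and reducible otherwise. For a monic polynomial $p(\zeta)=\prod_{j=1}^n(\zeta-\zeta_j)$ its discriminant is $\mathsf{D}_n(p)=\prod_{i<j}(\zeta_i-\zeta_j)^2$. For a separable algebroid function $f$ on $A$ the index of its discriminant is the degree of the map $z\mapsto \mathsf{D}_n(f_z)/|\mathsf{D}_n(f_z)|$ from the unit circle $\{|z|=1\}\subset A$ to itself. *)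

theory Defs
  imports "HOL-Complex_Analysis.Complex_Analysis"
    "HOL-Computational_Algebra.Computational_Algebra"
begin

text \<open>The outer radius is an extended real, so that \<open>R = \<infinity>\<close> is allowed.\<close>

definition annulus :: "real \<Rightarrow> ereal \<Rightarrow> complex set" where
  "annulus r R = {z. r < cmod z \<and> ereal (cmod z) < R}"

definition conformal_module :: "real \<Rightarrow> ereal \<Rightarrow> ereal" where
  "conformal_module r R =
     (if r = 0 \<or> R = \<infinity> then \<infinity>
      else ereal (1 / (2 * pi) * ln (real_of_ereal R / r)))"

text \<open>
  A function \<open>f(x, \<zeta>)\<close> that is polynomial in \<open>\<zeta>\<close> is represented by the map sending \<open>x\<close> to
  the polynomial \<open>f(x, \<cdot>)\<close>. Only its values on the base space \<open>X\<close> matter.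
\<close>

definition quasipolynomial :: "'a::topological_space set \<Rightarrow> nat \<Rightarrow> ('a \<Rightarrow> complex poly) \<Rightarrow> bool" where
  "quasipolynomial X n f \<longleftrightarrow>
     (\<forall>x\<in>X. degree (f x) = n \<and> lead_coeff (f x) = 1) \<and>
     (\<forall>j<n. continuous_on X (\<lambda>x. coeff (f x) j))"

definition separable_on :: "'a set \<Rightarrow> ('a \<Rightarrow> complex poly) \<Rightarrow> bool" where
  "separable_on X f \<longleftrightarrow> (\<forall>x\<in>X. rsquarefree (f x))"

definition algebroid_function :: "complex set \<Rightarrow> nat \<Rightarrow> (complex \<Rightarrow> complex poly) \<Rightarrow> bool" where
  "algebroid_function X n f \<longleftrightarrow>
     quasipolynomial X n f \<and> (\<forall>j<n. (\<lambda>x. coeff (f x) j) holomorphic_on X)"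

text \<open>The factors are only required to be continuous in \<open>x\<close>, even when \<open>f\<close> is holomorphic.\<close>

definition irreducible_on :: "'a::topological_space set \<Rightarrow> ('a \<Rightarrow> complex poly) \<Rightarrow> bool" where
  "irreducible_on X f \<longleftrightarrow>
     \<not> (\<exists>k l g h. k > 0 \<and> l > 0 \<and> quasipolynomial X k g \<and> quasipolynomial X l h \<and>
                  (\<forall>x\<in>X. f x = g x * h x))"

definition reducible_on :: "'a::topological_space set \<Rightarrow> ('a \<Rightarrow> complex poly) \<Rightarrow> bool" where
  "reducible_on X f \<longleftrightarrow> \<not> irreducible_on X f"

definition list_discriminant :: "complex list \<Rightarrow> complex" where
  "list_discriminant \<zeta> = (\<Prod>j<length \<zeta>. \<Prod>i<j. (\<zeta> ! i - \<zeta> ! j)\<^sup>2)"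

text \<open>
  Meaningful for monic \<open>p\<close> only; independence of the enumeration of the zeros is
  \<open>discriminant_eq\<close> below.
\<close>

definition discriminant :: "complex poly \<Rightarrow> complex" where
  "discriminant p = list_discriminant (SOME \<zeta>. p = (\<Prod>w\<leftarrow>\<zeta>. [:- w, 1:]))"

text \<open>
  The degree of a continuous self-map \<open>g\<close> of the unit circle is the total increment of a lift
  \<open>\<phi>\<close> of \<open>t \<mapsto> g(e\<^sup>2\<^sup>\<pi>\<^sup>i\<^sup>t)\<close> to the universal cover \<open>s \<mapsto> e\<^sup>2\<^sup>\<pi>\<^sup>i\<^sup>s\<close>.
\<close>

definition circle_degree :: "(complex \<Rightarrow> complex) \<Rightarrow> int" where
  "circle_degree g =
     (THE d. \<exists>\<phi>::real \<Rightarrow> real. continuous_on {0..1} \<phi> \<and>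
        (\<forall>t\<in>{0..1}. g (cis (2 * pi * t)) = cis (2 * pi * \<phi> t)) \<and>
        \<phi> 1 - \<phi> 0 = of_int d)"

definition discriminant_index :: "(complex \<Rightarrow> complex poly) \<Rightarrow> int" where
  "discriminant_index f =
     circle_degree (\<lambda>z. discriminant (f z) / of_real (cmod (discriminant (f z))))"

lemma list_discriminant_Nil [simp]: "list_discriminant [] = 1"
  by (simp add: list_discriminant_def)

lemma list_discriminant_Cons:
  "list_discriminant (x # xs) = (\<Prod>y\<leftarrow>xs. (x - y)\<^sup>2) * list_discriminant xs"
proof -
  have "list_discriminant (x # xs) =
      (\<Prod>j<length xs. \<Prod>i<Suc j. ((x # xs) ! i - xs ! j)\<^sup>2)"
    unfolding list_discriminant_def length_Cons prod.lessThan_Suc_shift by simp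
  also have "\<dots> = (\<Prod>j<length xs. (x - xs ! j)\<^sup>2 * (\<Prod>i<j. (xs ! i - xs ! j)\<^sup>2))"
    by (intro prod.cong refl) (subst prod.lessThan_Suc_shift, simp)
  also have "\<dots> = (\<Prod>j<length xs. (x - xs ! j)\<^sup>2) * list_discriminant xs"
    by (simp add: prod.distrib list_discriminant_def)
  also have "(\<Prod>j<length xs. (x - xs ! j)\<^sup>2) = (\<Prod>y\<leftarrow>xs. (x - y)\<^sup>2)"
    by (subst prod.list_conv_set_nth) (simp add: atLeast0LessThan)
  finally show ?thesis .
qed

lemma list_discriminant_move:
  "list_discriminant (us @ x # vs) = list_discriminant (x # us @ vs)"
  by (induction us) (simp_all add: list_discriminant_Cons power2_commute mult_ac)

lemma list_discriminant_perm:
  "mset xs = mset ys \<Longrightarrow> list_discriminant xs = list_discriminant ys"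
proof (induction xs arbitrary: ys)
  case (Cons x xs)
  then have "x \<in> set ys"
    by (metis list.set_intros(1) set_mset_mset)
  then obtain us vs where ys: "ys = us @ x # vs"
    by (meson split_list)
  with Cons.prems have m: "mset xs = mset (us @ vs)"
    by simp
  have "(\<Prod>y\<leftarrow>xs. (x - y)\<^sup>2) = (\<Prod>y\<leftarrow>us @ vs. (x - y)\<^sup>2)"
    using m by (metis mset_map prod_mset_prod_list)
  with Cons.IH[OF m] show ?case
    by (simp add: ys list_discriminant_move list_discriminant_Cons)
qed simp

lemma discriminant_eq:
  assumes "p = (\<Prod>w\<leftarrow>\<zeta>. [:- w, 1:])"
  shows "discriminant p = list_discriminant \<zeta>"
proof -
  have proots: "proots (\<Prod>w\<leftarrow>xs. [:- w, 1:]) = mset xs" for xs :: "complex list"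
  proof (induction xs)
    case (Cons a xs)
    have "(\<Prod>w\<leftarrow>xs. [:- w, 1:]) \<noteq> 0"
      by (auto simp: prod_list_zero_iff)
    with Cons show ?case
      by (simp add: proots_mult del: mult_pCons_left)
  qed simp
  show ?thesis
    unfolding discriminant_def
  proof (rule someI2)
    show "p = (\<Prod>w\<leftarrow>\<zeta>. [:- w, 1:])" by fact
  next
    fix \<xi> assume "p = (\<Prod>w\<leftarrow>\<xi>. [:- w, 1:])"
    with assms have "mset \<xi> = mset \<zeta>"
      by (metis proots)
    then show "list_discriminant \<xi> = list_discriminant \<zeta>"
      by (rule list_discriminant_perm)
  qed
qed

lemma circle_lift_unique:
  fixes \<phi> \<psi> :: "real \<Rightarrow> real"
  assumes "continuous_on {0..1} \<phi>" "continuous_on {0..1} \<psi>"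
    and eq: "\<And>t. t \<in> {0..1} \<Longrightarrow> cis (2 * pi * \<phi> t) = cis (2 * pi * \<psi> t)"
  shows "\<phi> 1 - \<phi> 0 = \<psi> 1 - \<psi> 0"
proof -
  let ?d = "\<lambda>t. \<phi> t - \<psi> t"
  have int: "?d t \<in> \<int>" if t: "t \<in> {0..1}" for t
  proof -
    have "cis (2 * pi * \<phi> t - 2 * pi * \<psi> t) = 1"
      by (simp add: eq[OF t] flip: cis_divide)
    then have "cos (2 * pi * ?d t) = 1"
      by (metis cis.sel(1) one_complex.sel(1) right_diff_distrib)
    then obtain k :: int where "2 * pi * ?d t = of_int k * (2 * pi)"
      by (metis cos_one_2pi_int mult.assoc)
    then show ?thesis by simp
  qed
  have "?d constant_on {0..1}"
  proof (rule continuous_discrete_range_constant)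
    show "continuous_on {0..1} ?d"
      using assms by (intro continuous_intros)
    fix x :: real assume x: "x \<in> {0..1}"
    show "\<exists>e>0. \<forall>y. y \<in> {0..1} \<and> ?d y \<noteq> ?d x \<longrightarrow> e \<le> norm (?d y - ?d x)"
    proof (intro exI[of _ 1] conjI allI impI)
      fix y assume y: "y \<in> {0..1} \<and> ?d y \<noteq> ?d x"
      then have "?d y - ?d x \<in> \<int>" "?d y - ?d x \<noteq> 0"
        using int x by (auto intro: Ints_diff)
      then show "1 \<le> norm (?d y - ?d x)"
        by (metis Ints_nonzero_abs_ge1 real_norm_def)
    qed auto
  qed auto
  then show ?thesis
    unfolding constant_on_def by (smt (verit) atLeastAtMost_iff)
qed

lemma circle_degree_eqI:
  assumes "continuous_on {0..1} \<phi>"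
    and "\<And>t. t \<in> {0..1} \<Longrightarrow> g (cis (2 * pi * t)) = cis (2 * pi * \<phi> t)"
    and "\<phi> 1 - \<phi> 0 = of_int d"
  shows "circle_degree g = d"
  unfolding circle_degree_def
proof (rule the_equality)
  fix e :: int
  assume "\<exists>\<psi>. continuous_on {0..1} \<psi> \<and>
        (\<forall>t\<in>{0..1}. g (cis (2 * pi * t)) = cis (2 * pi * \<psi> t)) \<and> \<psi> 1 - \<psi> 0 = of_int e"
  then obtain \<psi> where \<psi>: "continuous_on {0..1} \<psi>"
    "\<And>t. t \<in> {0..1} \<Longrightarrow> g (cis (2 * pi * t)) = cis (2 * pi * \<psi> t)" "\<psi> 1 - \<psi> 0 = of_int e"
    by auto
  have "\<phi> 1 - \<phi> 0 = \<psi> 1 - \<psi> 0"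
    by (rule circle_lift_unique) (use assms \<psi> in auto)
  with assms(3) \<psi>(3) show "e = d" by simp
qed (use assms in blast)

lemma circle_degree_eq_winding_number:
  assumes cont: "continuous_on (sphere 0 1) g" and g: "g \<in> sphere 0 1 \<rightarrow> sphere 0 1"
  shows "of_int (circle_degree g) = winding_number (g \<circ> circlepath 0 1) 0"
proof -
  let ?p = "g \<circ> circlepath 0 1"
  have cp: "circlepath 0 1 t = cis (2 * pi * t)" for t
    by (simp add: circlepath cis_conv_exp mult_ac)
  have p: "path ?p"
    by (rule path_continuous_image) (auto intro: continuous_on_subset[OF cont])
  have nz: "0 \<notin> path_image ?p"
  proof
    assume "0 \<in> path_image ?p"
    then obtain t where "g (cis (2 * pi * t)) = 0"
      by (auto simp: path_image_def cp)
    moreover have "g (cis (2 * pi * t)) \<in> sphere 0 1"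
      by (rule funcset_mem[OF g]) simp
    ultimately show False by simp
  qed
  obtain q where q: "path q"
    "pathfinish q - pathstart q = 2 * of_real pi * \<i> * winding_number ?p 0"
    "\<And>t. t \<in> {0..1} \<Longrightarrow> ?p t = 0 + exp (q t)"
    using winding_number_as_continuous_log[OF p nz] by blast
  have loop: "pathfinish ?p = pathstart ?p"
    by (simp add: pathfinish_def pathstart_def cp)
  obtain d :: int where d: "winding_number ?p 0 = of_int d"
    using integer_winding_number[OF p loop nz] by (auto elim: Ints_cases)
  have "circle_degree g = d"
  proof (rule circle_degree_eqI)
    show "continuous_on {0..1} (\<lambda>t. Im (q t) / (2 * pi))"
      using q(1) unfolding path_def by (intro continuous_intros) auto
    show "g (cis (2 * pi * t)) = cis (2 * pi * (Im (q t) / (2 * pi)))" if "t \<in> {0..1}" for t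
    proof -
      have eq: "g (cis (2 * pi * t)) = exp (q t)"
        using q(3)[OF that] by (simp add: cp)
      moreover have "cmod (g (cis (2 * pi * t))) = 1"
        using funcset_mem[OF g, of "cis (2 * pi * t)"] by simp
      ultimately have "Re (q t) = 0"
        by (simp add: norm_exp_eq_Re)
      then show ?thesis
        by (simp add: eq exp_eq_polar)
    qed
    have "Im (q 1) - Im (q 0) = 2 * pi * of_int d"
      using arg_cong[OF q(2), of Im] by (simp add: pathfinish_def pathstart_def d)
    then show "Im (q 1) / (2 * pi) - Im (q 0) / (2 * pi) = of_int d"
      by (simp flip: diff_divide_distrib)
  qed
  with d show ?thesis by simp
qed

end

theory Submission
  imports Defs "HOL-Number_Theory.Cong"
begin

text \<open>
  Suppose that \<open>f\<close> is irreducible. Pull it back along \<open>exp\<close> to the strip \<open>S\<close> over the annulus, where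
  the zeros become global functions. Irreducibility means that the monodromy of the annulus permutes
  them transitively, so there is one holomorphic function \<open>P\<close> on \<open>S\<close> whose translates \<open>p\<^sub>j(s) = P(s
  + 2\<pi>ij)\<close>, \<open>j\<close> modulo \<open>n\<close>, are all the zeros. A difference \<open>p\<^sub>i - p\<^sub>j\<close> of two of them vanishes
  nowhere. It has a winding number over the \<open>n\<close>-fold turn \<open>s \<mapsto> s + 2\<pi>in\<close>, which depends on \<open>j - i\<close>
  only. Adding them up, the index of the discriminant is the sum of the winding numbers of \<open>p\<^sub>0 -
  p\<^sub>1, \<dots>, p\<^sub>0 - p\<^sub>n\<^sub>-\<^sub>1\<close>. The proof shows that these numbers all have a common value \<open>w\<close> and that
  \<open>n\<close> does not divide \<open>w\<close>; then \<open>n\<close> does not divide the index \<open>(n - 1) w\<close> either.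

  The size of the annulus enters only through ratios of two differences that share a zero \<open>p\<^sub>i\<close>.
  Such a ratio omits 0 and 1, so its logarithm divided by \<open>2\<pi>i\<close> is a holomorphic function omitting
  all integers. In the variable \<open>(s - s\<^sub>0) / (2\<pi>in)\<close> it lives on the strip \<open>\<bar>Im z\<bar> < \<pi> / ln 2\<close>, and
  it can move only little along the real axis: this is \<open>strip_displacement_bound\<close>, a Landau type
  theorem with explicit constants. It follows from a version of Ahlfors' lemma (\<open>ahlfors_schwarz\<close>)
  for a metric on the complement of the integers that is built from hyperbolic metrics of punctured
  discs and of half-planes.

  Two consequences are used. First, in every triangle of zeros the two longest sides, as measured at
  one point of the core line, have the same winding number (\<open>two_longest_sides_same_winding\<close>). As
  \<open>n\<close> is prime, a combinatorial argument about edge colourings (\<open>colouring_contradiction\<close>) then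
  shows that all winding numbers agree. Secondly, if \<open>n\<close> is odd and divides the common value \<open>w\<close>,
  then for every \<open>k\<close> the ratio \<open>(p\<^sub>0 - p\<^sub>-\<^sub>k) / (p\<^sub>0 - p\<^sub>k)\<close> has a logarithm whose mean over the \<open>n\<close>
  turns is an odd multiple of \<open>\<pi>i\<close>, as if \<open>p\<^sub>0\<close> were the midpoint of \<open>p\<^sub>k\<close> and \<open>p\<^sub>-\<^sub>k\<close>. But if the
  numbering is such that \<open>p\<^sub>0 p\<^sub>k\<close> is longest among all sides at a point of the core line, then the
  ratio \<open>q\<close> lies in the lens \<open>\<bar>q\<bar> \<le> 1\<close>, \<open>\<bar>1 - q\<bar> \<le> 1\<close> there, and from there it cannot move far
  enough to have such a mean (\<open>strip_orbit_mean_not_half_odd\<close>). For \<open>n = 2\<close> the function \<open>p\<^sub>0 - p\<^sub>1\<close>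
  changes its sign under one turn, so that \<open>w\<close> is odd.
\<close>

section \<open>A Schwarz lemma for metrics supported by half-planes\<close>

text \<open>
  The hypothesis says that the hyperbolic derivative of \<open>g\<close> is largest at the centre. If it were
  greater than 1 there, then \<open>\<bar>g z\<bar> > \<bar>z\<bar>\<close> near 0, and the hypothesis would force \<open>\<bar>g' z\<bar> < \<bar>g' 0\<bar>\<close>
  for small \<open>z \<noteq> 0\<close>, against the maximum modulus principle for \<open>g'\<close>. This replaces the usual
  computation of curvatures in Ahlfors' lemma.
\<close>

lemma schwarz_at_local_maximum:
  fixes g :: "complex \<Rightarrow> complex"
  assumes "0 < \<delta>" and hol: "g holomorphic_on ball 0 \<delta>" and g0: "g 0 = 0"
    and le: "\<And>z. z \<in> ball 0 \<delta> \<Longrightarrow>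
       (1 - (cmod z)\<^sup>2) * cmod (deriv g z) \<le> cmod (deriv g 0) * (1 - (cmod (g z))\<^sup>2)"
  shows "cmod (deriv g 0) \<le> 1"
proof (rule ccontr)
  assume "\<not> ?thesis"
  then have C: "1 < cmod (deriv g 0)" by simp
  have "(g has_field_derivative deriv g 0) (at 0)"
    using hol \<open>0 < \<delta>\<close> by (intro holomorphic_derivI[of g "ball 0 \<delta>"]) auto
  then have "((\<lambda>z. g z / z) \<longlongrightarrow> deriv g 0) (at 0)"
    by (simp add: has_field_derivative_iff g0)
  then have "((\<lambda>z. cmod (g z / z)) \<longlongrightarrow> cmod (deriv g 0)) (at 0)"
    by (rule tendsto_norm)
  then have "\<forall>\<^sub>F z in at 0. 1 < cmod (g z / z)"
    using C by (rule order_tendstoD(1))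
  then obtain e where e: "0 < e" "\<And>z. z \<noteq> 0 \<Longrightarrow> cmod z < e \<Longrightarrow> 1 < cmod (g z / z)"
    unfolding eventually_at by (auto simp: dist_norm)
  define r where "r = min e (min \<delta> 1)"
  have r: "0 < r" "r \<le> \<delta>" "r \<le> 1" "r \<le> e" using e \<open>0 < \<delta>\<close> by (auto simp: r_def)
  have strict: "cmod (deriv g z) < cmod (deriv g 0)" if z: "z \<noteq> 0" "cmod z < r" for z
  proof -
    have "1 < cmod (g z / z)" using e(2)[of z] z r by auto
    then have "cmod z < cmod (g z)" using z by (simp add: norm_divide divide_simps split: if_splits)
    then have "(cmod z)\<^sup>2 < (cmod (g z))\<^sup>2" by (simp add: power_strict_mono)
    then have "cmod (deriv g 0) * (1 - (cmod (g z))\<^sup>2) < cmod (deriv g 0) * (1 - (cmod z)\<^sup>2)"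
      using C by (intro mult_strict_left_mono) auto
    then have "(1 - (cmod z)\<^sup>2) * cmod (deriv g z) < (1 - (cmod z)\<^sup>2) * cmod (deriv g 0)"
      using le[of z] z r by (auto simp: mult.commute)
    moreover have "(cmod z)\<^sup>2 < 1" using z r by (simp add: power_less_one_iff)
    ultimately show ?thesis by simp
  qed
  have "deriv g constant_on ball 0 r"
  proof (rule maximum_modulus_principle[of _ _ "ball 0 r" 0])
    show "deriv g holomorphic_on ball 0 r"
      using hol r by (intro holomorphic_deriv) (auto intro: holomorphic_on_subset)
    show "\<And>z. z \<in> ball 0 r \<Longrightarrow> cmod (deriv g z) \<le> cmod (deriv g 0)"
      using strict by (metis dist_0_norm less_eq_real_def mem_ball)
  qed (use r in auto)
  moreover have "of_real (r/2) \<in> ball (0::complex) r" "(0::complex) \<in> ball 0 r" using r by auto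
  ultimately have "deriv g (of_real (r/2)) = deriv g 0" 
    unfolding constant_on_def by metis
  with strict[of "of_real (r/2)"] r show False by auto
qed

lemma one_minus_norm_cayley:
  assumes "0 < Im a" "0 < Im b"
  shows "1 - (cmod ((a - b) / (a - cnj b)))\<^sup>2 = 4 * Im a * Im b / (cmod (a - cnj b))\<^sup>2"
proof -
  have nz: "a - cnj b \<noteq> 0" using assms by (auto simp: complex_eq_iff)
  have "(cmod (a - cnj b))\<^sup>2 - (cmod (a - b))\<^sup>2 = 4 * Im a * Im b"
    unfolding cmod_power2 by (simp add: power2_eq_square algebra_simps)
  moreover have "0 < (cmod (a - cnj b))\<^sup>2" using nz by simp
  ultimately show ?thesis
    by (simp add: norm_divide power_divide diff_divide_eq_iff)
qed

text \<open>
  The disc version transported by the Cayley map that takes \<open>A 0\<close> to 0.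
\<close>

lemma schwarz_at_local_maximum_halfplane:
  fixes A :: "complex \<Rightarrow> complex"
  assumes "0 < \<delta>" and hol: "A holomorphic_on ball 0 \<delta>"
    and im: "\<And>z. z \<in> ball 0 \<delta> \<Longrightarrow> 0 < Im (A z)"
    and le: "\<And>z. z \<in> ball 0 \<delta> \<Longrightarrow> (1 - (cmod z)\<^sup>2) * cmod (deriv A z) \<le> 2 * C * Im (A z)"
    and eq: "cmod (deriv A 0) = 2 * C * Im (A 0)"
  shows "C \<le> 1"
proof -
  define b where "b = A 0"
  have b: "0 < Im b" using im[of 0] assms(1) by (simp add: b_def)
  define g where "g = (\<lambda>z. (A z - b) / (A z - cnj b))"
  have nz: "A z - cnj b \<noteq> 0" if "z \<in> ball 0 \<delta>" for z
    using im[OF that] b by (auto simp: complex_eq_iff)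
  have dg: "cmod (deriv g z) = cmod (deriv A z) * (2 * Im b) / (cmod (A z - cnj b))\<^sup>2"
    if z: "z \<in> ball 0 \<delta>" for z
  proof -
    have dA: "(A has_field_derivative deriv A z) (at z)"
      using hol z by (intro holomorphic_derivI[of A "ball 0 \<delta>"]) auto
    have "(g has_field_derivative
       (deriv A z * (A z - cnj b) - (A z - b) * deriv A z) / ((A z - cnj b) * (A z - cnj b))) (at z)"
      unfolding g_def using nz[OF z] by (auto intro!: derivative_eq_intros dA)
    then have "deriv g z = (deriv A z * (b - cnj b)) / (A z - cnj b)^2"
      by (simp add: DERIV_imp_deriv algebra_simps power2_eq_square)
    moreover have "cmod (b - cnj b) = 2 * Im b"
      using b by (simp add: complex_diff_cnj norm_mult)
    ultimately show ?thesis by (simp add: norm_mult norm_divide norm_power)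
  qed
  have one: "1 - (cmod (g z))\<^sup>2 = 4 * Im (A z) * Im b / (cmod (A z - cnj b))\<^sup>2"
    if z: "z \<in> ball 0 \<delta>" for z
    unfolding g_def by (rule one_minus_norm_cayley) (use im[OF z] b in auto)
  have g0: "g 0 = 0" by (simp add: g_def b_def)
  have z0: "0 \<in> ball (0::complex) \<delta>" using assms(1) by simp
  have dg0: "cmod (deriv g 0) = C"
    using one[OF z0] b unfolding dg[OF z0] eq g0 by (simp add: b_def field_simps)
  show ?thesis unfolding dg0[symmetric]
  proof (rule schwarz_at_local_maximum[where g = g, OF assms(1) _ g0])
    show "g holomorphic_on ball 0 \<delta>"
      unfolding g_def using nz by (intro holomorphic_intros hol) auto
    fix z :: complex assume z: "z \<in> ball 0 \<delta>"
    have "(1 - (cmod z)\<^sup>2) * cmod (deriv A z) * (2 * Im b) / (cmod (A z - cnj b))\<^sup>2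
        \<le> 2 * C * Im (A z) * (2 * Im b) / (cmod (A z - cnj b))\<^sup>2"
      using le[OF z] b by (intro divide_right_mono mult_right_mono) auto
    then show "(1 - (cmod z)\<^sup>2) * cmod (deriv g z) \<le> cmod (deriv g 0) * (1 - (cmod (g z))\<^sup>2)"
      unfolding dg0 dg[OF z] one[OF z]
      by (simp add: mult_ac del: right_diff_distrib_numeral left_diff_distrib_numeral)
  qed
qed

text \<open>
  The number \<open>\<eta> v\<close> is the reciprocal of the density of a conformal metric. The map \<open>a\<close> pulls the
  hyperbolic metric of the upper half-plane back to a metric that lies below it near \<open>w\<close> and touches
  it at \<open>w\<close>; this expresses curvature at most \<open>-1\<close> for a metric that need not be smooth.
\<close>

definition supported_by_halfplane :: "(complex \<Rightarrow> real) \<Rightarrow> complex \<Rightarrow> bool" where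
  "supported_by_halfplane \<eta> w \<longleftrightarrow>
     (\<exists>\<delta>>0. \<exists>a. a holomorphic_on ball w \<delta> \<and>
        (\<forall>v\<in>ball w \<delta>. 0 < Im (a v) \<and> cmod (deriv a v) * \<eta> v \<le> Im (a v)) \<and>
        cmod (deriv a w) * \<eta> w = Im (a w))"

lemma moebius_disc:
  fixes c z :: complex
  assumes "cmod c < 1" "cmod z < 1"
  shows "1 + cnj c * z \<noteq> 0"
    and "cmod ((z + c) / (1 + cnj c * z)) < 1"
    and "(1 - (cmod z)\<^sup>2) * cmod ((1 - cnj c * c) / (1 + cnj c * z)\<^sup>2)
           = 1 - (cmod ((z + c) / (1 + cnj c * z)))\<^sup>2"
proof -
  have "cmod (cnj c * z) < 1" using assms by (simp add: norm_mult) (metis mult_strict_mono' norm_ge_zero mult_1)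
  then show nz: "1 + cnj c * z \<noteq> 0"
    by (metis add.inverse_unique norm_minus_cancel norm_one order_less_irrefl)
  have c1: "(cmod c)\<^sup>2 < 1" "(cmod z)\<^sup>2 < 1" using assms by (auto simp: power_less_one_iff)
  have "(cmod (1 + cnj c * z))\<^sup>2 - (cmod (z + c))\<^sup>2 = (1 - (cmod c)\<^sup>2) * (1 - (cmod z)\<^sup>2)"
    unfolding cmod_power2 by (simp add: power2_eq_square algebra_simps)
  then have id: "1 - (cmod ((z + c) / (1 + cnj c * z)))\<^sup>2
      = (1 - (cmod c)\<^sup>2) * (1 - (cmod z)\<^sup>2) / (cmod (1 + cnj c * z))\<^sup>2"
    using nz by (simp add: norm_divide power_divide field_simps)
  have "0 < (1 - (cmod c)\<^sup>2) * (1 - (cmod z)\<^sup>2) / (cmod (1 + cnj c * z))\<^sup>2"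
    using c1 nz by (intro divide_pos_pos mult_pos_pos) auto
  then have "(cmod ((z + c) / (1 + cnj c * z)))\<^sup>2 < 1" using id by simp
  then show "cmod ((z + c) / (1 + cnj c * z)) < 1" by (simp add: power_less_one_iff)
  have "1 - cnj c * c = of_real (1 - (cmod c)\<^sup>2)"
    by (simp add: mult.commute[of "cnj c"] flip: complex_norm_square)
  then have "cmod (1 - cnj c * c) = 1 - (cmod c)\<^sup>2"
    using c1 by (metis abs_of_nonneg diff_ge_0_iff_ge less_imp_le norm_of_real)
  then show "(1 - (cmod z)\<^sup>2) * cmod ((1 - cnj c * c) / (1 + cnj c * z)\<^sup>2)
           = 1 - (cmod ((z + c) / (1 + cnj c * z)))\<^sup>2"
    unfolding id by (simp add: norm_divide norm_power mult_ac)
qed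

text \<open>
  The quotient \<open>u\<close> of the pulled back metric and the hyperbolic metric of the disc attains its
  maximum, unless it vanishes, at an inner point \<open>c\<close>. After a Moebius map moves \<open>c\<close> to the centre,
  composition with the supporting map at \<open>f c\<close> reduces the estimate of \<open>u c\<close> to a local maximum of a
  map into the half-plane.
\<close>

lemma ahlfors_schwarz_closed_disc:
  fixes f :: "complex \<Rightarrow> complex"
  assumes cont: "continuous_on \<Omega> \<eta>" and pos: "\<And>w. w \<in> \<Omega> \<Longrightarrow> 0 < \<eta> w"
    and supp: "\<And>w. w \<in> \<Omega> \<Longrightarrow> supported_by_halfplane \<eta> w"
    and U: "open U" "cball 0 1 \<subseteq> U" and hol: "f holomorphic_on U" and im: "f ` U \<subseteq> \<Omega>"
  shows "cmod (deriv f 0) \<le> 2 * \<eta> (f 0)"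
proof -
  define u where "u = (\<lambda>z. (1 - (cmod z)\<^sup>2) * cmod (deriv f z) / \<eta> (f z))"
  have fc: "continuous_on (cball 0 1) f"
    using hol U by (meson continuous_on_subset holomorphic_on_imp_continuous_on)
  have "continuous_on (cball 0 1) (deriv f)"
    using hol U by (meson continuous_on_subset holomorphic_on_imp_continuous_on holomorphic_deriv)
  moreover have "continuous_on (cball 0 1) (\<lambda>z. \<eta> (f z))"
    by (rule continuous_on_compose2[OF cont fc]) (use im U in auto)
  ultimately have "continuous_on (cball 0 1) u"
    unfolding u_def using pos im U by (intro continuous_intros) force+
  then obtain c where c: "c \<in> cball 0 1" and max: "\<And>z. z \<in> cball 0 1 \<Longrightarrow> u z \<le> u c"
    using continuous_attains_sup[of "cball 0 1" u] by fastforce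
  have "u c \<le> 2"
  proof (cases "cmod c < 1")
    case False
    with c have "u c = 0" by (simp add: u_def)
    then show ?thesis by simp
  next
    case c1: True
    define w where "w = f c"
    have "w \<in> \<Omega>" using c U im unfolding w_def by blast
    from supp[OF this] obtain \<delta> a where \<delta>: "0 < \<delta>" and a: "a holomorphic_on ball w \<delta>"
      "\<And>v. v \<in> ball w \<delta> \<Longrightarrow> 0 < Im (a v)"
      "\<And>v. v \<in> ball w \<delta> \<Longrightarrow> cmod (deriv a v) * \<eta> v \<le> Im (a v)"
      "cmod (deriv a w) * \<eta> w = Im (a w)"
      unfolding supported_by_halfplane_def by blast
    define m where "m = (\<lambda>z. (z + c) / (1 + cnj c * z))"
    have m1: "cmod (m z) < 1" if "cmod z < 1" for z using moebius_disc(2)[OF c1 that] by (simp add: m_def)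
    have mU: "m z \<in> U" if "cmod z < 1" for z using m1[OF that] U by auto
    have dm: "(m has_field_derivative (1 - cnj c * c) / (1 + cnj c * z)\<^sup>2) (at z)" if "cmod z < 1" for z
      unfolding m_def using moebius_disc(1)[OF c1 that]
      by (auto intro!: derivative_eq_intros simp: power2_eq_square algebra_simps)
    have mh: "m holomorphic_on ball 0 1"
      unfolding m_def using moebius_disc(1)[OF c1] by (intro holomorphic_intros) auto
    have Fh: "(\<lambda>z. f (m z)) holomorphic_on ball 0 1"
      using holomorphic_on_compose_gen[OF mh hol] mU by (fastforce simp: o_def)
    have "isCont (\<lambda>z. f (m z)) 0"
      using holomorphic_on_imp_continuous_on[OF Fh] by (simp add: continuous_on_eq_continuous_at)
    then obtain e where e: "0 < e" "\<And>z. cmod z < e \<Longrightarrow> dist (f (m z)) (f (m 0)) < \<delta>"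
      using \<delta> unfolding continuous_at_eps_delta by (auto simp: dist_norm)
    define e' where "e' = min e 1"
    have e': "0 < e'" "\<And>z. cmod z < e' \<Longrightarrow> f (m z) \<in> ball w \<delta>" "\<And>z. cmod z < e' \<Longrightarrow> cmod z < 1"
      using e by (auto simp: e'_def m_def w_def dist_commute)
    define A where "A = (\<lambda>z. a (f (m z)))"
    have dA: "cmod (deriv A z) = cmod (deriv a (f (m z))) * cmod (deriv f (m z)) * 
       cmod ((1 - cnj c * c) / (1 + cnj c * z)\<^sup>2)" if z: "cmod z < e'" for z
    proof -
      have d1: "(f has_field_derivative deriv f (m z)) (at (m z))"
        using hol U mU[OF e'(3)[OF z]] by (intro holomorphic_derivI[of f U]) auto
      have d2: "(a has_field_derivative deriv a (f (m z))) (at (f (m z)))"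
        using a(1) e'(2)[OF z] by (intro holomorphic_derivI[of a "ball w \<delta>"]) auto
      have "(A has_field_derivative deriv a (f (m z)) * (deriv f (m z) * ((1 - cnj c * c) / (1 + cnj c * z)\<^sup>2))) (at z)"
        unfolding A_def
        by (rule DERIV_chain2[where f = a and g = "\<lambda>z. f (m z)", OF d2
              DERIV_chain2[where f = f and g = m, OF d1 dm[OF e'(3)[OF z]]]])
      then show ?thesis by (simp add: DERIV_imp_deriv norm_mult norm_divide)
    qed
    have key: "(1 - (cmod z)\<^sup>2) * cmod (deriv A z) = cmod (deriv a (f (m z))) * \<eta> (f (m z)) * u (m z)"
      if z: "cmod z < e'" for z
    proof -
      have "0 < \<eta> (f (m z))" using pos im mU[OF e'(3)[OF z]] by auto
      then have "cmod (deriv f (m z)) * (1 - (cmod (m z))\<^sup>2) = \<eta> (f (m z)) * u (m z)"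
        by (simp add: u_def)
      moreover have "(1 - (cmod z)\<^sup>2) * cmod (deriv A z) = cmod (deriv a (f (m z))) *
          (cmod (deriv f (m z)) * ((1 - (cmod z)\<^sup>2) * cmod ((1 - cnj c * c) / (1 + cnj c * z)\<^sup>2)))"
        unfolding dA[OF z] by (simp only: mult_ac)
      ultimately show ?thesis
        unfolding moebius_disc(3)[OF c1 e'(3)[OF z]] m_def by simp
    qed
    have uc: "0 \<le> u c" using c pos[OF \<open>w \<in> \<Omega>\<close>] c1 unfolding u_def w_def
      by (intro divide_nonneg_pos mult_nonneg_nonneg) (auto simp: power_le_one)
    have m0: "m 0 = c" by (simp add: m_def)
    have "u c / 2 \<le> 1"
    proof (rule schwarz_at_local_maximum_halfplane[OF e'(1), of A])
      show "A holomorphic_on ball 0 e'"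
        unfolding A_def 
        by (rule holomorphic_on_compose_gen[OF holomorphic_on_subset[OF Fh] a(1), unfolded o_def])
          (use e' in auto)
      show "0 < Im (A z)" if "z \<in> ball 0 e'" for z
        unfolding A_def by (rule a(2)) (use that e' in auto)
      show "(1 - (cmod z)\<^sup>2) * cmod (deriv A z) \<le> 2 * (u c / 2) * Im (A z)" if "z \<in> ball 0 e'" for z
      proof -
        have z: "cmod z < e'" using that by simp
        have "cmod (deriv a (f (m z))) * \<eta> (f (m z)) * u (m z) 
            \<le> cmod (deriv a (f (m z))) * \<eta> (f (m z)) * u c"
          using max[of "m z"] m1[OF e'(3)[OF z]] pos[of "f (m z)"] im mU[OF e'(3)[OF z]]
          by (intro mult_left_mono mult_nonneg_nonneg) (auto intro: less_imp_le)
        also have "\<dots> \<le> Im (A z) * u c"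
          unfolding A_def using a(3)[OF e'(2)[OF z]] uc by (rule mult_right_mono)
        finally show ?thesis using key[OF z] by (simp add: mult.commute)
      qed
      show "cmod (deriv A 0) = 2 * (u c / 2) * Im (A 0)"
        using key[of 0] e' a(4) by (simp add: m0 A_def w_def mult.commute)
    qed
    then show ?thesis by simp
  qed
  then have "u 0 \<le> 2" using max[of 0] by simp
  moreover have "0 \<in> U" using U(2) by (metis centre_in_cball subsetD zero_le_one)
  then have "0 < \<eta> (f 0)" using pos im by blast
  ultimately show ?thesis by (simp add: u_def field_simps)
qed

text \<open>
  The case of the open disc follows by exhausting it with the discs of radius \<open>r < 1\<close>.
\<close>

lemma ahlfors_schwarz:
  fixes f :: "complex \<Rightarrow> complex"
  assumes "continuous_on \<Omega> \<eta>" and "\<And>w. w \<in> \<Omega> \<Longrightarrow> 0 < \<eta> w"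
    and "\<And>w. w \<in> \<Omega> \<Longrightarrow> supported_by_halfplane \<eta> w"
    and hol: "f holomorphic_on ball 0 1" and im: "f ` ball 0 1 \<subseteq> \<Omega>"
  shows "cmod (deriv f 0) \<le> 2 * \<eta> (f 0)"
proof -
  have step: "r * cmod (deriv f 0) \<le> 2 * \<eta> (f 0)" if r: "0 < r" "r < 1" for r :: real
  proof -
    let ?g = "\<lambda>z. f (of_real r * z)"
    have ball: "of_real r * z \<in> ball 0 1" if "z \<in> ball 0 (1/r)" for z :: complex
      using that r by (simp add: norm_mult field_simps)
    have "cmod (deriv ?g 0) \<le> 2 * \<eta> (?g 0)"
    proof (rule ahlfors_schwarz_closed_disc[OF assms(1-3), where U = "ball 0 (1/r)"])
      have "1 < 1 / r" using r by simp
      then show "cball 0 1 \<subseteq> ball (0::complex) (1 / r)" by auto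
      show "?g holomorphic_on ball 0 (1 / r)"
        by (rule holomorphic_on_compose_gen[OF _ hol, of "\<lambda>z. of_real r * z", unfolded o_def])
           (use ball in \<open>auto intro!: holomorphic_intros\<close>)
      show "?g ` ball 0 (1/r) \<subseteq> \<Omega>" using ball im by blast
    qed auto
    moreover have "(?g has_field_derivative deriv f 0 * of_real r) (at 0)"
    proof (rule DERIV_chain2[where f=f and g = "\<lambda>z. of_real r * z"])
      show "(f has_field_derivative deriv f 0) (at (of_real r * 0))"
        using holomorphic_derivI[OF hol, of 0] by simp
    qed (auto intro!: derivative_eq_intros)
    ultimately show ?thesis using r by (simp add: DERIV_imp_deriv norm_mult mult.commute)
  qed
  have "((\<lambda>r. r * cmod (deriv f 0)) \<longlongrightarrow> 1 * cmod (deriv f 0)) (at_left 1)"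
    by (intro tendsto_intros)
  moreover have "\<forall>\<^sub>F r in at_left (1::real). r * cmod (deriv f 0) \<le> 2 * \<eta> (f 0)"
    using eventually_at_left_real[OF zero_less_one] by (rule eventually_mono) (use step in auto)
  ultimately have "1 * cmod (deriv f 0) \<le> 2 * \<eta> (f 0)"
    by (intro tendsto_upperbound) auto
  then show ?thesis by simp
qed

section \<open>A metric on the complement of the integers\<close>

text \<open>
  Near an integer at distance \<open>d\<close> the metric is that of the punctured disc of radius 12, whose
  density is \<open>1 / (d ln (12 / d))\<close>. Beyond \<open>12 / exp 2\<close> the profile is continued by its tangent of
  slope 1.
\<close>

definition integer_profile :: "real \<Rightarrow> real" where
  "integer_profile d = (if d \<le> 12 / exp 2 then d * ln (12 / d) else d + 12 / exp 2)"

text \<open>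
  Far from the real axis the metric is that of a half-plane bounded by a horizontal line at distance
  \<open>8/5\<close> on the other side of the axis. The constants 12 and \<open>8/5\<close> make the two metrics fit: at a
  real point the profile is at most \<open>ln 24 / 2 < 8/5\<close>, so that the kink of the absolute value is not
  seen, and \<open>8/5 < 12 / exp 2\<close> makes the half-plane metric take over before the tangent is used.
\<close>

definition omit_integers_scale :: "complex \<Rightarrow> real" where
  "omit_integers_scale w = min (\<bar>Im w\<bar> + 8/5) (integer_profile (infdist w \<int>))"

lemma exp_1_lower: "2718/1000 \<le> exp (1::real)"
proof -
  have "\<bar>exp 1 - 5837465777 / 2147483648\<bar> \<le> inverse (2 ^ 32::real)" by (rule e_approx_32)
  moreover have "inverse (2 ^ 32::real) \<le> 1/1000000" by simp
  ultimately show ?thesis by linarith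
qed

lemma exp_2_3_bounds: "7 < exp (2::real)" "8/5 < 12 / exp (2::real)" "20 \<le> exp (3::real)"
proof -
  have "\<bar>exp 1 - 5837465777 / 2147483648\<bar> \<le> inverse (2 ^ 32::real)" by (rule e_approx_32)
  moreover have "inverse (2 ^ 32::real) \<le> 1/1000000" by simp
  ultimately have u: "exp (1::real) \<le> 27183/10000" by linarith
  note l = exp_1_lower
  have e2: "exp (2::real) = exp 1 ^ 2" "exp (3::real) = exp 1 ^ 3"
    using exp_of_nat_mult[of 2 "1::real"] exp_of_nat_mult[of 3 "1::real"] by simp_all
  have "(2718/1000::real) ^ 2 \<le> exp 1 ^ 2" "exp 1 ^ 2 \<le> (27183/10000::real)^2" "(2718/1000::real) ^ 3 \<le> exp 1 ^ 3"
    using l u by (auto intro!: power_mono)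
  then show "7 < exp (2::real)" "8/5 < 12 / exp (2::real)" "20 \<le> exp (3::real)"
    unfolding e2 by (auto simp: power2_eq_square power3_eq_cube field_simps)
qed

lemma ln_24_less: "ln (24::real) < 16/5"
proof -
  have "(27/10::real) ^ 16 \<le> exp 1 ^ 16" using exp_1_lower by (intro power_mono) auto
  moreover have "exp 1 ^ 16 = exp (16::real)" using exp_of_nat_mult[of 16 "1::real"] by simp
  ultimately have "24 ^ 5 < exp (16::real)" by (simp add: power_divide)
  then have lt: "ln (24 ^ 5) < (16::real)"
    by (metis exp_gt_zero ln_exp ln_less_cancel_iff zero_less_numeral zero_less_power)
  have eq: "ln ((24::real) ^ 5) = 5 * ln 24" by (subst ln_realpow) simp_all
  show ?thesis using lt unfolding eq by simp
qed

lemma twelve_div_exp_2_less: "12 / exp 2 < (12::real)"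
  using exp_2_3_bounds(1) by (simp add: divide_less_eq)

text \<open>
  The function \<open>x ln (12 / x)\<close> increases as long as \<open>ln (12 / x) \<ge> 1\<close>; therefore the nearest integer
  gives the smallest profile.
\<close>

lemma times_ln_mono:
  fixes x y :: real
  assumes "0 \<le> x" "x \<le> y" "y \<le> 12 / exp 2"
  shows "x * ln (12 / x) \<le> y * ln (12 / y)"
proof (cases "x = 0")
  case True
  have "y \<le> 12" using assms twelve_div_exp_2_less by linarith
  then have "0 \<le> y * ln (12 / y)" using assms True
    by (cases "y = 0") (auto intro!: mult_nonneg_nonneg ln_ge_zero)
  then show ?thesis using True by simp
next
  case False
  with assms have p: "0 < x" "0 < y" by auto
  have "exp 2 \<le> 12 / y" using assms(3) p by (simp add: pos_le_divide_eq mult.commute)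
  then have "2 \<le> ln (12 / y)" using p by (subst ln_ge_iff) auto
  then have "(y - x) * 1 \<le> (y - x) * ln (12 / y)" using assms by (intro mult_left_mono) auto
  moreover have "x * ln (y / x) \<le> x * (y / x - 1)" 
    using p by (intro mult_left_mono ln_le_minus_one) auto
  moreover have "x * (y / x - 1) = y - x" using p by (simp add: field_simps)
  moreover have "ln (12 / x) = ln (12 / y) + ln (y / x)"
    using p by (simp add: ln_div)
  ultimately show ?thesis by (simp add: algebra_simps)
qed

lemma integer_profile_mono_le:
  assumes "0 \<le> x" "x \<le> y" "y \<le> 12 / exp 2"
  shows "integer_profile x \<le> y * ln (12 / y)"
  using times_ln_mono[OF assms] assms by (auto simp: integer_profile_def)

lemma integer_profile_ge:
  assumes "12 / exp 2 \<le> d"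
  shows "integer_profile d = d + 12 / exp 2"
  using assms by (auto simp: integer_profile_def)

lemma infdist_Ints_attained:
  obtains m :: int where "infdist (w::complex) \<int> = cmod (w - of_int m)"
proof -
  obtain x :: complex where "x \<in> \<int>" "infdist w \<int> = dist w x"
    using infdist_attains_inf[of "\<int> :: complex set" w] closed_Ints by blast
  then show ?thesis using that by (auto simp: dist_norm elim!: Ints_cases)
qed

lemma infdist_Ints_le: "infdist (w::complex) \<int> \<le> cmod (w - of_int m)"
  by (metis Ints_of_int dist_norm infdist_le)

lemma infdist_Ints_pos: "w \<notin> \<int> \<Longrightarrow> 0 < infdist (w::complex) \<int>"
  by (metis Ints_0 closed_Ints empty_iff in_closed_iff_infdist_zero infdist_nonneg less_eq_real_def)

lemma infdist_Ints_real: 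
  assumes "Im w = 0" shows "infdist w \<int> \<le> 1/2"
proof -
  have w: "w = of_real (Re w)" using assms by (simp add: complex_eq_iff)
  have "w - of_int (round (Re w)) = of_real (Re w - of_int (round (Re w)))" using w by simp
  then have "cmod (w - of_int (round (Re w))) \<le> 1/2"
    using of_int_round_abs_le[of "Re w"] by (metis abs_minus_commute norm_of_real)
  then show ?thesis using infdist_Ints_le order_trans by blast
qed

text \<open>
  Where the half-plane metric is active, the supporting map is a translation, preceded by
  \<open>v \<mapsto> - v\<close> in the lower half-plane. Where the punctured disc metric is active, it is a
  branch of \<open>- \<i> ln ((v - m) / 12)\<close> for a nearest integer \<open>m\<close>.
\<close>

lemma supported_omit_integers_scale:
  assumes w: "w \<notin> \<int>"
  shows "supported_by_halfplane omit_integers_scale w"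
proof -
  let ?d = "infdist w \<int>"
  let ?K = "12 / exp (2::real)"
  obtain m :: int where m: "?d = cmod (w - of_int m)" by (rule infdist_Ints_attained)
  have d: "0 < ?d" using w by (rule infdist_Ints_pos)
  show ?thesis
  proof (cases "\<bar>Im w\<bar> + 8/5 \<le> integer_profile ?d")
    case True
    have "Im w \<noteq> 0"
    proof
      assume 0: "Im w = 0"
      have "integer_profile ?d \<le> 1/2 * ln (12 / (1/2))"
        using infdist_Ints_real[OF 0] d exp_2_3_bounds(2) by (intro integer_profile_mono_le) linarith+
      also have "\<dots> < 8/5" using ln_24_less by simp
      finally show False using True 0 by simp
    qed
    define \<sigma> where "\<sigma> = sgn (Im w)"
    have \<sigma>: "\<bar>\<sigma>\<bar> = 1" using \<open>Im w \<noteq> 0\<close> by (simp add: \<sigma>_def)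
    define a where "a = (\<lambda>v::complex. of_real \<sigma> * v + \<i> * of_real (8/5))"
    have da: "deriv a v = of_real \<sigma>" for v
      unfolding a_def by (rule DERIV_imp_deriv) (auto intro!: derivative_eq_intros)
    have Ima: "Im (a v) = \<bar>Im v\<bar> + 8/5" if "v \<in> ball w \<bar>Im w\<bar>" for v
    proof -
      have "\<bar>Im v - Im w\<bar> < \<bar>Im w\<bar>"
        using abs_Im_le_cmod[of "v - w"] that by (simp add: dist_norm norm_minus_commute)
      then show ?thesis using \<open>Im w \<noteq> 0\<close> by (auto simp: a_def \<sigma>_def sgn_if)
    qed
    show ?thesis
      unfolding supported_by_halfplane_def
    proof (intro exI[of _ "\<bar>Im w\<bar>"] exI[of _ a] conjI ballI)
      show "0 < \<bar>Im w\<bar>" using \<open>Im w \<noteq> 0\<close> by simp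
      show "a holomorphic_on ball w \<bar>Im w\<bar>" unfolding a_def by (intro holomorphic_intros)
      show "cmod (deriv a w) * omit_integers_scale w = Im (a w)"
        using True Ima[of w] \<open>Im w \<noteq> 0\<close> \<sigma> by (simp add: da omit_integers_scale_def)
      fix v assume v: "v \<in> ball w \<bar>Im w\<bar>"
      show "0 < Im (a v)" using Ima[OF v] by simp
      show "cmod (deriv a v) * omit_integers_scale v \<le> Im (a v)"
        using \<sigma> by (simp add: Ima[OF v] da omit_integers_scale_def)
    qed
  next
    case False
    have "\<bar>Im w\<bar> \<le> ?d" unfolding m using abs_Im_le_cmod[of "w - of_int m"] by simp
    have dK: "?d < ?K"
    proof (rule ccontr)
      assume "\<not> ?thesis"
      then have "integer_profile ?d = ?d + ?K" by (intro integer_profile_ge) simp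
      with False \<open>\<bar>Im w\<bar> \<le> ?d\<close> exp_2_3_bounds(2) show False by linarith
    qed
    define \<delta> where "\<delta> = min ?d (?K - ?d)"
    define a where "a = (\<lambda>v. - \<i> * (Ln ((v - of_int m) / (w - of_int m)) + of_real (ln (?d / 12))))"
    have wm: "w - of_int m \<noteq> 0" using d m by auto
    have v1: "0 < Re ((v - of_int m) / (w - of_int m))" "v - of_int m \<noteq> 0" "cmod (v - of_int m) < ?K"
      if v: "v \<in> ball w \<delta>" for v
    proof -
      have vw: "cmod (v - w) < ?d" "cmod (v - w) < ?K - ?d" 
        using v by (auto simp: \<delta>_def dist_norm norm_minus_commute)
      have "(v - of_int m) / (w - of_int m) - 1 = (v - w) / (w - of_int m)"
        using wm by (simp add: field_simps)
      then have "cmod ((v - of_int m) / (w - of_int m) - 1) < 1"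
        using vw d by (simp add: norm_divide m)
      then show p: "0 < Re ((v - of_int m) / (w - of_int m))"
        using abs_Re_le_cmod[of "(v - of_int m) / (w - of_int m) - 1"] by simp
      then show "v - of_int m \<noteq> 0" by auto
      show "cmod (v - of_int m) < ?K"
        using norm_triangle_ineq[of "v - w" "w - of_int m"] vw by (simp add: m)
    qed
    have Ima: "Im (a v) = ln (12 / cmod (v - of_int m))" if v: "v \<in> ball w \<delta>" for v
    proof -
      have p: "0 < cmod (v - of_int m)" using v1(2)[OF v] by simp
      have nz: "(v - of_int m) / (w - of_int m) \<noteq> 0" using v1(2)[OF v] wm by simp
      have "Im (a v) = - (ln (cmod (v - of_int m) / ?d) + ln (?d / 12))"
        using nz by (simp add: a_def norm_divide m)
      also have "\<dots> = - ln (cmod (v - of_int m) / 12)"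
        using p d by (simp add: ln_div)
      also have "\<dots> = ln (12 / cmod (v - of_int m))"
        using p by (simp add: ln_div)
      finally show ?thesis .
    qed
    have da: "(a has_field_derivative - \<i> / (v - of_int m)) (at v)" if v: "v \<in> ball w \<delta>" for v
    proof -
      have "(v - of_int m) / (w - of_int m) \<notin> \<real>\<^sub>\<le>\<^sub>0"
        using v1(1)[OF v] by (auto simp: complex_nonpos_Reals_iff)
      then have "((\<lambda>v. Ln ((v - of_int m) / (w - of_int m))) has_field_derivative
          inverse ((v - of_int m) / (w - of_int m)) * (1 / (w - of_int m))) (at v)"
        by (intro DERIV_chain2[OF has_field_derivative_Ln]) (auto intro!: derivative_eq_intros)
      moreover have "inverse ((v - of_int m) / (w - of_int m)) * (1 / (w - of_int m)) = 1 / (v - of_int m)"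
        using wm by simp
      ultimately have "((\<lambda>v. Ln ((v - of_int m) / (w - of_int m))) has_field_derivative
          1 / (v - of_int m)) (at v)"
        by (simp only:)
      then have "(a has_field_derivative - \<i> * (1 / (v - of_int m) + 0)) (at v)"
        unfolding a_def by (intro DERIV_cmult DERIV_add DERIV_const)
      then show ?thesis by simp
    qed
    note K12 = twelve_div_exp_2_less
    have pos: "0 < Im (a v)" if v: "v \<in> ball w \<delta>" for v
    proof -
      have "0 < cmod (v - of_int m)" "cmod (v - of_int m) < 12" using v1(2)[OF v] order_less_trans[OF v1(3)[OF v] K12] by simp_all
      then show ?thesis unfolding Ima[OF v] by (intro ln_gt_zero) (simp add: less_divide_eq)
    qed
    show ?thesis
      unfolding supported_by_halfplane_def
    proof (intro exI[of _ \<delta>] exI[of _ a] conjI ballI)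
      show "0 < \<delta>" using d dK by (simp add: \<delta>_def)
      then have w\<delta>: "w \<in> ball w \<delta>" by simp
      show "a holomorphic_on ball w \<delta>"
        using da by (meson holomorphic_on_open open_ball)
      show "cmod (deriv a w) * omit_integers_scale w = Im (a w)"
        using False d dK w\<delta>
        by (simp add: DERIV_imp_deriv[OF da] Ima omit_integers_scale_def integer_profile_def m norm_divide)
      fix v assume v: "v \<in> ball w \<delta>"
      show "0 < Im (a v)" using v by (rule pos)
      have "omit_integers_scale v \<le> integer_profile (infdist v \<int>)" by (simp add: omit_integers_scale_def)
      also have "\<dots> \<le> cmod (v - of_int m) * ln (12 / cmod (v - of_int m))"
        using v1(3)[OF v] infdist_Ints_le infdist_nonneg by (intro integer_profile_mono_le) auto
      finally show "cmod (deriv a v) * omit_integers_scale v \<le> Im (a v)"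
        using v1(2)[OF v] by (simp add: DERIV_imp_deriv[OF da[OF v]] Ima[OF v] norm_divide field_simps)
    qed
  qed
qed

lemma integer_profile_pos: "0 < d \<Longrightarrow> 0 < integer_profile d"
proof -
  assume d: "0 < d"
  show ?thesis
  proof (cases "d \<le> 12 / exp 2")
    case True
    then have "d < 12" using twelve_div_exp_2_less by linarith
    then show ?thesis using True d by (auto simp: integer_profile_def intro!: mult_pos_pos ln_gt_zero)
  qed (use d in \<open>auto simp: integer_profile_def intro!: add_pos_pos\<close>)
qed

text \<open>
  The tangent line of \<open>d ln (12 / d)\<close> of slope 2, which touches at \<open>d = 12 / exp 3\<close>, lies above the
  profile. A linear bound is what turns the derivative estimate into exponential growth later.
\<close>

lemma integer_profile_le: "0 < d \<Longrightarrow> d \<le> 12 / exp 2 \<Longrightarrow> integer_profile d \<le> 2 * d + 3/5"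
proof -
  assume d: "0 < d" "d \<le> 12 / exp 2"
  have "ln (12 / exp 3 / d) \<le> 12 / exp 3 / d - 1" using d by (intro ln_le_minus_one) auto
  then have "d * ln (12 / exp 3 / d) \<le> d * (12 / exp 3 / d - 1)" using d by (intro mult_left_mono) auto
  also have "\<dots> = 12 / exp 3 - d" using d by (simp add: field_simps)
  also have "12 / exp 3 \<le> (3/5::real)" using exp_2_3_bounds(3) by (simp add: field_simps)
  finally have "d * ln (12 / exp 3 / d) \<le> 3/5 - d" by simp
  moreover have "ln (12 / d) = 3 + ln (12 / exp 3 / d)"
    using d by (simp add: ln_div ln_mult)
  then have "d * ln (12 / d) = 3 * d + d * ln (12 / exp 3 / d)" by (simp add: distrib_left)
  ultimately have "d * ln (12 / d) \<le> 2 * d + 3/5" by linarith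
  then show ?thesis using d by (simp add: integer_profile_def)
qed

lemma omit_integers_scale_le:
  assumes "w \<notin> \<int>"
  shows "omit_integers_scale w \<le> 2 * (cmod (w - of_int m) + 3/10)"
proof (cases "infdist w \<int> \<le> 12 / exp 2")
  case True
  then have "integer_profile (infdist w \<int>) \<le> 2 * infdist w \<int> + 3/5"
    using infdist_Ints_pos[OF assms] by (rule integer_profile_le[rotated])
  then show ?thesis using infdist_Ints_le[of w m] by (simp add: omit_integers_scale_def)
next
  case False
  then have "8/5 < cmod (w - of_int m)" using infdist_Ints_le[of w m] exp_2_3_bounds(2) by linarith
  moreover have "\<bar>Im w\<bar> \<le> cmod (w - of_int m)" using abs_Im_le_cmod[of "w - of_int m"] by simp
  ultimately show ?thesis by (simp add: omit_integers_scale_def)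
qed

lemma continuous_on_integer_profile: "continuous_on {0<..} integer_profile"
proof -
  have "continuous_on {0<..} (\<lambda>d::real. if d \<le> 12 / exp 2 then d * ln (12 / d) else d + 12 / exp 2)"
    by (intro continuous_on_cases_le continuous_intros) auto
  then show ?thesis by (simp add: integer_profile_def[abs_def])
qed

lemma continuous_on_omit_integers_scale: "continuous_on (- \<int>) omit_integers_scale"
proof -
  have "continuous_on (- \<int>) (\<lambda>w::complex. integer_profile (infdist w \<int>))"
    by (rule continuous_on_compose2[OF continuous_on_integer_profile])
       (auto intro!: continuous_intros infdist_Ints_pos)
  then show ?thesis
    unfolding omit_integers_scale_def[abs_def] by (intro continuous_intros)
qed

text \<open>
  A theorem of Landau type with an explicit linear bound. The value \<open>3/10\<close> bounds half of \<open>12 / exp 3\<close>.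
\<close>

lemma landau_omit_integers:
  assumes "f holomorphic_on ball 0 1" "\<And>z. z \<in> ball 0 1 \<Longrightarrow> f z \<notin> \<int>"
  shows "cmod (deriv f 0) \<le> 4 * (cmod (f 0 - of_int m) + 3/10)"
proof -
  have "cmod (deriv f 0) \<le> 2 * omit_integers_scale (f 0)"
  proof (rule ahlfors_schwarz[OF continuous_on_omit_integers_scale])
    show "\<And>w. w \<in> - \<int> \<Longrightarrow> 0 < omit_integers_scale w"
      by (auto simp: omit_integers_scale_def intro!: add_nonneg_pos integer_profile_pos infdist_Ints_pos)
  qed (use assms supported_omit_integers_scale in auto)
  also have "\<dots> \<le> 2 * (2 * (cmod (f 0 - of_int m) + 3/10))"
    using omit_integers_scale_le[of "f 0" m] assms(2) by (intro mult_left_mono) auto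
  finally show ?thesis by simp
qed

section \<open>Displacement along the axis of a strip\<close>

text \<open>
  With the half-width \<open>\<pi> / ln 2\<close> the hyperbolic density on the real axis is \<open>ln 2 / 2\<close>. Movement by
  \<open>1/2\<close> along the axis then amounts to a growth factor \<open>sqrt 2\<close>.
\<close>

definition strip :: "complex set" where
  "strip = {z. \<bar>Im z\<bar> < pi / ln 2}"

lemma open_strip: "open strip"
  unfolding strip_def by (intro open_Collect_less continuous_intros)

lemma of_real_in_strip [simp]: "of_real t \<in> strip"
  by (simp add: strip_def)

text \<open>
  The conformal map \<open>J\<close> of the disc onto the strip centred at \<open>t\<close> has \<open>J' 0 = 4 / ln 2\<close>.
\<close>

lemma strip_derivative_bound:
  assumes hol: "G holomorphic_on strip" and om: "\<And>z. z \<in> strip \<Longrightarrow> G z \<notin> \<int>"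
  shows "cmod (deriv G (of_real t)) \<le> ln 2 * (cmod (G (of_real t) - of_int m) + 3/10)"
proof -
  define J where "J = (\<lambda>u::complex. of_real t + of_real (2 / ln 2) * Ln ((1 + u) / (1 - u)))"
  have Re: "0 < Re ((1 + u) / (1 - u))" if "cmod u < 1" for u
  proof -
    have "(cmod u)\<^sup>2 < 1" using that by (simp add: power_less_one_iff)
    then have "0 < Re ((1 + u) * cnj (1 - u))"
      unfolding cmod_power2 by (simp add: algebra_simps power2_eq_square)
    then show ?thesis by (simp add: Re_complex_div_gt_0)
  qed
  have u1: "1 - u \<noteq> 0" if "cmod u < 1" for u :: complex using that by auto
  have strip: "J u \<in> strip" if "cmod u < 1" for u
  proof -
    have "\<bar>Im (Ln ((1 + u) / (1 - u)))\<bar> < pi / 2" using Re[OF that] by (rule Re_Ln_pos_lt_imp)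
    then have "2 / ln 2 * \<bar>Im (Ln ((1 + u) / (1 - u)))\<bar> < 2 / ln 2 * (pi / 2)"
      by (intro mult_strict_left_mono) auto
    then show ?thesis by (simp add: J_def strip_def abs_mult)
  qed
  have notin: "(1 + u) / (1 - u) \<notin> \<real>\<^sub>\<le>\<^sub>0" if "cmod u < 1" for u
    using Re[OF that] by (auto simp: complex_nonpos_Reals_iff)
  have Jh: "J holomorphic_on ball 0 1"
    unfolding J_def using notin u1 by (intro holomorphic_intros) auto
  have "((\<lambda>u::complex. (1 + u) / (1 - u)) has_field_derivative 2) (at 0)"
    by (auto intro!: derivative_eq_intros)
  then have "((\<lambda>u. Ln ((1 + u) / (1 - u))) has_field_derivative inverse ((1 + 0) / (1 - 0)) * 2) (at (0::complex))"
    by (intro DERIV_chain2[OF has_field_derivative_Ln]) auto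
  then have dJ: "(J has_field_derivative of_real (4 / ln 2)) (at 0)"
    unfolding J_def by (auto intro!: derivative_eq_intros)
  have J0: "J 0 = of_real t" by (simp add: J_def)
  have dG: "(G has_field_derivative deriv G (of_real t)) (at (J 0))"
    unfolding J0 using holomorphic_derivI[OF hol open_strip] by simp
  have "deriv (\<lambda>u. G (J u)) 0 = deriv G (of_real t) * of_real (4 / ln 2)"
    by (rule DERIV_imp_deriv, rule DERIV_chain2[where f = G and g = J, OF dG dJ])
  moreover have "cmod (deriv (\<lambda>u. G (J u)) 0) \<le> 4 * (cmod (G (J 0) - of_int m) + 3/10)"
  proof (rule landau_omit_integers)
    show "(\<lambda>u. G (J u)) holomorphic_on ball 0 1"
      by (rule holomorphic_on_compose_gen[OF Jh hol, unfolded o_def]) (use strip in auto)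
  qed (use om strip in auto)
  ultimately have "cmod (deriv G (of_real t)) * (4 / ln 2) \<le> 4 * (cmod (G (of_real t) - of_int m) + 3/10)"
    by (simp add: norm_mult J0 norm_divide)
  then show ?thesis by (simp add: field_simps)
qed

text \<open>
  A Gronwall estimate. Let \<open>M\<close> be the maximum of \<open>(B + \<bar>f t - f 0\<bar>) exp (- k t)\<close>. At a point where
  it is attained, integrating the bound \<open>\<bar>f' t\<bar> \<le> k M exp (k t)\<close> shows that \<open>M \<le> B\<close>.
\<close>

lemma affine_growth_bound:
  fixes f :: "real \<Rightarrow> complex"
  assumes "0 \<le> \<tau>" "0 \<le> k" "0 < b"
    and f': "\<And>t. (f has_vector_derivative f' t) (at t)"
    and le: "\<And>t. norm (f' t) \<le> k * (norm (f t - c) + b)"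
  shows "norm (f \<tau> - f 0) \<le> (exp (k * \<tau>) - 1) * (norm (f 0 - c) + b)"
proof -
  define B where "B = norm (f 0 - c) + b"
  define w where "w = (\<lambda>t. (B + norm (f t - f 0)) * exp (- (k * t)))"
  have cont: "continuous_on A f" for A
    using f' by (meson continuous_at_imp_continuous_on has_vector_derivative_continuous)
  have "continuous_on {0..\<tau>} w"
    unfolding w_def by (intro continuous_intros cont)
  then obtain s where s: "s \<in> {0..\<tau>}" and max: "\<And>t. t \<in> {0..\<tau>} \<Longrightarrow> w t \<le> w s"
    using continuous_attains_sup[of "{0..\<tau>}" w] assms(1) by fastforce
  define M where "M = w s"
  have wM: "B + norm (f t - f 0) \<le> M * exp (k * t)" if "t \<in> {0..\<tau>}" for t
    using max[OF that] by (simp add: w_def M_def exp_minus field_simps)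
  have Ms: "B + norm (f s - f 0) = M * exp (k * s)"
    by (simp add: w_def M_def exp_minus)
  have "M \<le> B"
  proof (cases "s = 0")
    case True
    then show ?thesis by (simp add: M_def w_def)
  next
    case False
    have "norm (f s - f 0) \<le> M * exp (k * s) - M * exp (k * 0)"
    proof (rule differentiable_bound_general[of 0 s f "\<lambda>t. M * exp (k * t)" f' "\<lambda>t. k * (M * exp (k * t))"])
      show "0 < s" using s False by auto
      fix t assume t: "0 < t" "t < s"
      show "(f has_vector_derivative f' t) (at t)" by (rule f')
      show "((\<lambda>t. M * exp (k * t)) has_vector_derivative k * (M * exp (k * t))) (at t)"
        by (auto intro!: derivative_eq_intros simp: has_real_derivative_iff_has_vector_derivative[symmetric])
      have "norm (f t - c) \<le> norm (f 0 - c) + norm (f t - f 0)"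
        using norm_triangle_ineq[of "f 0 - c" "f t - f 0"] by simp
      then have "norm (f t - c) + b \<le> M * exp (k * t)"
        using wM[of t] t s by (auto simp: B_def)
      then show "norm (f' t) \<le> k * (M * exp (k * t))"
        using le[of t] assms(2) by (meson mult_left_mono order_trans)
    qed (auto intro!: cont continuous_intros)
    then show ?thesis using Ms by simp
  qed
  then have "B + norm (f \<tau> - f 0) \<le> B * exp (k * \<tau>)"
    using wM[of \<tau>] assms(1) by (smt (verit) atLeastAtMost_iff exp_gt_zero mult_right_mono)
  then show ?thesis by (simp add: B_def algebra_simps)
qed

text \<open>
  By the derivative bound, \<open>\<bar>G - m\<bar> + 3/10\<close> grows at most by the factor \<open>2 powr \<bar>t - s\<bar>\<close>. The
  constant \<open>83/200\<close> is slightly larger than \<open>sqrt 2 - 1\<close>.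
\<close>

lemma strip_displacement_bound:
  assumes hol: "G holomorphic_on strip" and om: "\<And>z. z \<in> strip \<Longrightarrow> G z \<notin> \<int>"
    and t: "\<bar>t - s\<bar> \<le> 1/2"
  shows "cmod (G (of_real t) - G (of_real s)) \<le> 83/200 * (cmod (G (of_real s) - of_int m) + 3/10)"
proof -
  define \<sigma> where "\<sigma> = (if s \<le> t then 1 else - 1 :: real)"
  have \<sigma>: "\<bar>\<sigma>\<bar> = 1" "s + \<sigma> * \<bar>t - s\<bar> = t" by (auto simp: \<sigma>_def)
  define f where "f = (\<lambda>x::real. G (of_real (s + \<sigma> * x)))"
  have "cmod (f \<bar>t - s\<bar> - f 0) \<le> (exp (ln 2 * \<bar>t - s\<bar>) - 1) * (cmod (f 0 - of_int m) + 3/10)"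
  proof (rule affine_growth_bound)
    fix x :: real
    have "(G has_field_derivative deriv G (of_real (s + \<sigma> * x))) (at (of_real (s + \<sigma> * x)))"
      using holomorphic_derivI[OF hol open_strip of_real_in_strip] .
    moreover have "((\<lambda>x. of_real (s + \<sigma> * x) :: complex) has_vector_derivative of_real \<sigma>) (at x)"
      by (auto intro!: derivative_eq_intros has_vector_derivative_of_real)
    ultimately show "(f has_vector_derivative of_real \<sigma> * deriv G (of_real (s + \<sigma> * x))) (at x)"
      using field_vector_diff_chain_at[of "\<lambda>x. of_real (s + \<sigma> * x)" "of_real \<sigma>" x G "deriv G (of_real (s + \<sigma> * x))"]
      by (simp add: o_def f_def)
    show "cmod (of_real \<sigma> * deriv G (of_real (s + \<sigma> * x))) \<le> ln 2 * (cmod (f x - of_int m) + 3/10)"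
      using strip_derivative_bound[OF hol om] \<sigma> by (simp add: norm_mult f_def del: of_real_add of_real_mult)
  qed auto
  also have "exp (ln 2 * \<bar>t - s\<bar>) - 1 \<le> 83/200"
  proof -
    have "exp (ln 2 * \<bar>t - s\<bar>) \<le> exp (ln 2 * (1/2::real))" using t by simp
    also have "\<dots> = sqrt 2" by (simp add: powr_def flip: powr_half_sqrt)
    also have "\<dots> \<le> 283/200" by (rule real_le_lsqrt) (auto simp: power2_eq_square)
    finally show ?thesis by simp
  qed
  finally have "cmod (f \<bar>t - s\<bar> - f 0) \<le> 83/200 * (cmod (f 0 - of_int m) + 3/10)"
    by (simp add: mult_right_mono)
  then show ?thesis unfolding f_def \<sigma>(2) by simp
qed

lemma principal_branch_shift:
  assumes q: "q = exp (2 * of_real pi * \<i> * z)"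
  obtains m :: int where "Re z - of_int m = Im (Ln q) / (2 * pi)" "Im z = - ln (cmod q) / (2 * pi)"
proof -
  have "exp (2 * of_real pi * \<i> * z) = exp (Ln q)" using q by simp
  then obtain m :: int where m: "2 * of_real pi * \<i> * z = Ln q + (of_int (2 * m) * pi) * \<i>"
    unfolding exp_eq by blast
  have "Re z - of_int m = Im (Ln q) / (2 * pi)"
    using arg_cong[OF m, of Im] by (simp add: field_simps)
  moreover have "Im z = - ln (cmod q) / (2 * pi)"
    using arg_cong[OF m, of Re] q by (simp add: field_simps)
  ultimately show ?thesis by (rule that)
qed

lemma Re_eq_cos_Im_Ln: "q \<noteq> 0 \<Longrightarrow> Re q = cmod q * cos (Im (Ln q))"
  using exp_Ln[of q] by (metis Re_exp Re_Ln exp_ln zero_less_norm_iff)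

text \<open>
  If \<open>y\<close> lies in this part of the disc, its logarithm is so small that \<open>Y\<close>, up to an integer \<open>m\<close>,
  is near the omitted value 0. It therefore moves by less than \<open>1/3\<close> in both directions along half a
  period, which leaves no room for a non-zero integral increment.
\<close>

lemma strip_winding_eq_0:
  assumes hol: "Y holomorphic_on strip" and om: "\<And>z. z \<in> strip \<Longrightarrow> Y z \<notin> \<int>"
    and \<beta>: "Y (of_real (s + 1/2)) = Y (of_real (s - 1/2)) + of_int \<beta>"
    and y: "y = exp (2 * of_real pi * \<i> * Y (of_real s))" "cmod y \<le> 1" "1/2 \<le> Re y"
  shows "\<beta> = 0"
proof -
  obtain m :: int where m: "Re (Y (of_real s)) - of_int m = Im (Ln y) / (2 * pi)"
     "Im (Y (of_real s)) = - ln (cmod y) / (2 * pi)"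
    using principal_branch_shift[OF y(1)] by blast
  have y0: "y \<noteq> 0" using y by auto
  have l: "1/2 \<le> cmod y" using y(3) complex_Re_le_cmod[of y] by linarith
  then have "0 < cmod y" by linarith
  have "0 < cmod y * cos (Im (Ln y))" using Re_eq_cos_Im_Ln[OF y0] y(3) by linarith
  then have "0 < cos (Im (Ln y))" using \<open>0 < cmod y\<close> by (rule zero_less_mult_pos)
  then have "cmod y * cos (Im (Ln y)) \<le> 1 * cos (Im (Ln y))" using y(2) by (intro mult_right_mono) auto
  then have cos: "1/2 \<le> cos (Im (Ln y))" using Re_eq_cos_Im_Ln[OF y0] y(3) by linarith
  have "\<bar>Im (Ln y)\<bar> \<le> pi / 3"
  proof (rule ccontr)
    assume "\<not> ?thesis"
    moreover have "\<bar>Im (Ln y)\<bar> < pi / 2" using y(3) by (intro Re_Ln_pos_lt_imp) linarith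
    ultimately have "cos \<bar>Im (Ln y)\<bar> < cos (pi / 3)"
      by (intro cos_monotone_0_pi) auto
    with cos show False by (simp add: cos_60)
  qed
  then have R: "\<bar>Re (Y (of_real s)) - of_int m\<bar> \<le> 1/6"
    unfolding m by (simp add: abs_mult field_simps)
  have "ln (1/2) \<le> ln (cmod y)" using l by (subst ln_le_cancel_iff) auto
  then have "\<bar>ln (cmod y)\<bar> \<le> ln 2" using y(2) \<open>0 < cmod y\<close> by (simp add: ln_div)
  then have "\<bar>ln (cmod y)\<bar> / (2 * pi) \<le> (7/10) / (2 * 3)"
    using ln2_le_25_over_36 pi_gt3 by (intro frac_le) auto
  then have I: "\<bar>Im (Y (of_real s))\<bar> \<le> 7/60"
    unfolding m by (simp add: abs_mult)
  have "cmod (Y (of_real s) - of_int m) \<le> 1/6 + 7/60"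
    using cmod_le[of "Y (of_real s) - of_int m"] R I by simp
  then have D: "cmod (Y (of_real t) - Y (of_real s)) < 1/3" if "\<bar>t - s\<bar> \<le> 1/2" for t
    using strip_displacement_bound[OF hol om that, of m] by simp
  have "\<bar>Re (Y (of_real (s + 1/2))) - Re (Y (of_real s))\<bar> < 1/3" "\<bar>Re (Y (of_real (s - 1/2))) - Re (Y (of_real s))\<bar> < 1/3"
    using D[of "s + 1/2"] D[of "s - 1/2"] 
      abs_Re_le_cmod[of "Y (of_real (s + 1/2)) - Y (of_real s)"] abs_Re_le_cmod[of "Y (of_real (s - 1/2)) - Y (of_real s)"]
    by auto
  then have "\<bar>Re (Y (of_real (s + 1/2))) - Re (Y (of_real (s - 1/2)))\<bar> < 1" by linarith
  then show ?thesis unfolding \<beta> by simp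
qed

text \<open>
  The Cauchy-Schwarz inequality for the vector \<open>(1, 3/4)\<close>, whose length is \<open>5/4\<close>.
\<close>

lemma cmod_le_linear:
  fixes z :: complex
  shows "\<bar>Re z\<bar> + 3/4 * \<bar>Im z\<bar> \<le> 5/4 * cmod z"
proof (rule power2_le_imp_le)
  define a b where "a = \<bar>Re z\<bar>" and "b = \<bar>Im z\<bar>"
  have "0 \<le> (3/4 * a - b)\<^sup>2" by simp
  also have "\<dots> = 25/16 * (a\<^sup>2 + b\<^sup>2) - (a + 3/4 * b)\<^sup>2"
    by (simp add: power2_eq_square algebra_simps)
  also have "a\<^sup>2 + b\<^sup>2 = (cmod z)\<^sup>2" by (simp add: a_def b_def cmod_power2)
  finally have "(a + 3/4 * b)\<^sup>2 \<le> 25/16 * (cmod z)\<^sup>2" by simp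
  then show "(\<bar>Re z\<bar> + 3/4 * \<bar>Im z\<bar>)\<^sup>2 \<le> (5/4 * cmod z)\<^sup>2"
    by (simp add: a_def b_def power_mult_distrib power_divide)
qed simp

lemma lens_numeric:
  fixes x y d :: real
  assumes "0 \<le> x" "x \<le> 1/4" "0 \<le> y" "y < 1/10 \<Longrightarrow> x \<le> 211/1000"
    and d: "d = sqrt (x\<^sup>2 + y\<^sup>2)"
  shows "x - 3/4 * y + 83/160 * d + 249/1600 < 1/2"
proof (cases "y < 1/10")
  case True
  have "d \<le> x + y" unfolding d using assms by (intro sqrt_sum_squares_le_sum) auto
  with assms(4)[OF True] assms(3) show ?thesis by linarith
next
  case False
  have "x\<^sup>2 \<le> (1/4)\<^sup>2" using assms by (intro power_mono) auto
  then have "83/160 * sqrt (x\<^sup>2 + y\<^sup>2) \<le> 83/160 * sqrt (1/16 + y\<^sup>2)"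
    by (intro mult_left_mono real_sqrt_le_mono) (auto simp: power2_eq_square)
  also have "\<dots> < 94/1000 + 3/4 * y"
  proof (rule power2_less_imp_less)
    have "(83/160 * sqrt (1/16 + y\<^sup>2))\<^sup>2 = (83/160)\<^sup>2 * (1/16 + y\<^sup>2)"
      by (simp only: power_mult_distrib real_sqrt_pow2_iff) simp
    also have "\<dots> < (94/1000)\<^sup>2 + 2 * (94/1000) * (3/4) * y + (3/4)\<^sup>2 * y\<^sup>2"
      using False by (simp add: power2_eq_square[of "_ / _"]) (use zero_le_power2[of y] in linarith)
    also have "\<dots> = (94/1000 + 3/4 * y)\<^sup>2"
      by (simp add: power2_eq_square algebra_simps)
    finally show "(83/160 * sqrt (1/16 + y\<^sup>2))\<^sup>2 < (94/1000 + 3/4 * y)\<^sup>2" .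
  qed (use False in auto)
  finally show ?thesis using assms(2) by (simp add: d)
qed

text \<open>
  The inequality confines \<open>G - m\<close> to a wedge that opens upwards. At \<open>s\<close> the lens condition gives
  \<open>\<bar>x\<bar> \<le> 1/4\<close> and \<open>y \<ge> 0\<close> for \<open>G - m = x + iy\<close>, and near the real axis the second disc improves this
  to \<open>\<bar>x\<bar> \<le> 211/1000\<close>. The possible displacement grows with \<open>y\<close>, but more slowly than the wedge
  widens.
\<close>

lemma strip_lens_bound:
  assumes hol: "G holomorphic_on strip" and om: "\<And>z. z \<in> strip \<Longrightarrow> G z \<notin> \<int>"
    and q: "q = exp (2 * of_real pi * \<i> * G (of_real s))" "cmod q \<le> 1" "cmod (1 - q) \<le> 1"
  obtains m :: int where "\<And>t. \<bar>t - s\<bar> \<le> 1/2 \<Longrightarrow>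
    \<bar>Re (G (of_real t)) - of_int m\<bar> - 3/4 * Im (G (of_real t)) < 1/2"
proof -
  obtain m :: int where m: "Re (G (of_real s)) - of_int m = Im (Ln q) / (2 * pi)"
     "Im (G (of_real s)) = - ln (cmod q) / (2 * pi)"
    using principal_branch_shift[OF q(1)] by blast
  have q0: "q \<noteq> 0" using q by auto
  then have qp: "0 < cmod q" by simp
  define x where "x = \<bar>Im (Ln q)\<bar> / (2 * pi)"
  define y where "y = - ln (cmod q) / (2 * pi)"
  define d where "d = cmod (G (of_real s) - of_int m)"
  have "(cmod (1 - q))\<^sup>2 \<le> 1" using q(3) by (simp add: power_le_one)
  then have "(cmod q)\<^sup>2 \<le> 2 * Re q"
    unfolding cmod_power2 by (simp add: power2_eq_square algebra_simps)
  then have "cmod q * cmod q \<le> cmod q * (2 * cos (Im (Ln q)))"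
    unfolding Re_eq_cos_Im_Ln[OF q0] by (simp add: power2_eq_square mult_ac)
  then have c: "cmod q / 2 \<le> cos (Im (Ln q))" using qp by simp
  then have "0 < cos (Im (Ln q))" using qp by linarith
  then have "0 < Re q" unfolding Re_eq_cos_Im_Ln[OF q0] using qp by simp
  then have lt: "\<bar>Im (Ln q)\<bar> < pi / 2" by (rule Re_Ln_pos_lt_imp)
  have x: "0 \<le> x" "x \<le> 1/4" using lt by (auto simp: x_def divide_le_eq)
  have y: "0 \<le> y" unfolding y_def using q(2) qp by (intro divide_nonneg_pos) auto
  have pi32: "pi \<le> 32/10" using pi_approx(2) by (rule order_trans) simp
  have small: "x \<le> 211/1000" if "y < 1/10"
  proof -
    have "- ln (cmod q) = y * (2 * pi)" by (simp add: y_def)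
    also have "\<dots> < 1/10 * (2 * pi)" using that by (intro mult_strict_right_mono) auto
    also have "\<dots> \<le> 2/3" using pi_approx(2) by simp
    also have "\<dots> \<le> ln 2" by (rule ln2_ge_two_thirds)
    finally have "ln (1/2) < ln (cmod q)" by (simp add: ln_div)
    then have "1/2 < cmod q" using qp by simp
    then have "1/4 < cos \<bar>Im (Ln q)\<bar>" using c by simp
    also have "\<dots> = sin (pi / 2 - \<bar>Im (Ln q)\<bar>)" by (simp add: sin_diff)
    also have "\<dots> \<le> pi / 2 - \<bar>Im (Ln q)\<bar>" using lt by (intro sin_x_le_x) auto
    finally have "\<bar>Im (Ln q)\<bar> \<le> 211/1000 * (2 * pi)" using pi32 by linarith
    then show ?thesis by (simp add: x_def divide_le_eq)
  qed
  have xy: "\<bar>Re (G (of_real s)) - of_int m\<bar> = x" "Im (G (of_real s)) = y"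
    unfolding m by (simp_all add: x_def y_def abs_mult)
  have "d = sqrt (x\<^sup>2 + y\<^sup>2)" unfolding d_def cmod_def by (simp flip: xy)
  then have num: "x - 3/4 * y + 83/160 * d + 249/1600 < 1/2"
    using lens_numeric[OF x y small] by blast
  show ?thesis
  proof (rule that[of m])
    fix t assume t: "\<bar>t - s\<bar> \<le> 1/2"
    define D where "D = cmod (G (of_real t) - G (of_real s))"
    define u where "u = \<bar>Re (G (of_real t)) - Re (G (of_real s))\<bar>"
    define v where "v = \<bar>Im (G (of_real t)) - Im (G (of_real s))\<bar>"
    have "D \<le> 83/200 * (d + 3/10)"
      unfolding d_def D_def by (rule strip_displacement_bound[OF hol om t])
    moreover have "u + 3/4 * v \<le> 5/4 * D"
      using cmod_le_linear[of "G (of_real t) - G (of_real s)"] by (simp add: u_def v_def D_def)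
    moreover have "\<bar>Re (G (of_real t)) - of_int m\<bar> \<le> x + u" "y - v \<le> Im (G (of_real t))"
      unfolding xy[symmetric] u_def v_def by linarith+
    ultimately show "\<bar>Re (G (of_real t)) - of_int m\<bar> - 3/4 * Im (G (of_real t)) < 1/2"
      using num by argo
  qed
qed

text \<open>
  The wedge \<open>\<bar>Re z\<bar> - 3/4 Im z < 1/2\<close> is convex and contains no half of an odd integer, so it cannot
  contain \<open>n\<close> points whose mean, after subtraction of the integer \<open>m\<close>, is such a number.
\<close>

lemma strip_orbit_mean_not_half_odd:
  assumes hol: "G holomorphic_on strip" and om: "\<And>z. z \<in> strip \<Longrightarrow> G z \<notin> \<int>"
    and per: "\<And>t::real. G (of_real (t + 1)) = G (of_real t)"
    and q: "q = exp (2 * of_real pi * \<i> * G (of_real s))" "cmod q \<le> 1" "cmod (1 - q) \<le> 1"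
    and n: "0 < n"
    and sum: "(\<Sum>j<n. G (of_real (s + real j / real n))) = of_nat n * of_int c / 2"
  shows "even c"
proof -
  obtain m :: int where m0: "\<And>t. \<bar>t - s\<bar> \<le> 1/2 \<Longrightarrow>
    \<bar>Re (G (of_real t)) - of_int m\<bar> - 3/4 * Im (G (of_real t)) < 1/2"
    using strip_lens_bound[OF hol om q] by blast
  have m: "\<bar>Re (G (of_real (s + j / n))) - of_int m\<bar> - 3/4 * Im (G (of_real (s + j / n))) < 1/2"
    if j: "j < n" for j
  proof (cases "real j / n \<le> 1/2")
    case True
    then show ?thesis by (intro m0) auto
  next
    case False
    \<comment> \<open>the second half of the orbit is reached backwards, one period earlier\<close>
    have "real j / n < 1" using j by simp
    then have "\<bar>Re (G (of_real (s + j / n - 1))) - of_int m\<bar> - 3/4 * Im (G (of_real (s + j / n - 1))) < 1/2"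
      using False by (intro m0) auto
    then show ?thesis using per[of "s + j / n - 1"] by simp
  qed
  let ?R = "\<lambda>j. Re (G (of_real (s + real j / n)))" and ?I = "\<lambda>j. Im (G (of_real (s + real j / n)))"
  have R: "(\<Sum>j<n. ?R j) = n * c / 2" using arg_cong[OF sum, of Re] by simp
  have I: "(\<Sum>j<n. ?I j) = 0" using arg_cong[OF sum, of Im] by simp
  have "\<bar>\<Sum>j<n. ?R j - of_int m\<bar> \<le> (\<Sum>j<n. \<bar>?R j - of_int m\<bar>)" by (rule sum_abs)
  also have "\<dots> = (\<Sum>j<n. \<bar>?R j - of_int m\<bar> - 3/4 * ?I j)"
    using I by (simp only: sum_subtractf sum_distrib_left[symmetric])
  also have "\<dots> < (\<Sum>j<n. 1/2)" using m n by (intro sum_strict_mono) auto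
  also have "(\<Sum>j<n. ?R j - of_int m) = real n * (c / 2 - m)"
    unfolding sum_subtractf R by (simp add: algebra_simps)
  finally have "\<bar>real n * (c / 2 - m)\<bar> < n / 2" by simp
  then have "real n * \<bar>c / 2 - m\<bar> < n * (1/2)" by (simp add: abs_mult)
  then have "\<bar>c / 2 - m\<bar> < (1/2::real)" using n by simp
  then have "\<bar>c - 2 * m\<bar> < 1" by linarith
  then show ?thesis by presburger
qed

section \<open>Edge colourings of triangles\<close>

definition two_longest_sides_agree :: "'v set \<Rightarrow> ('v \<Rightarrow> 'v \<Rightarrow> 'c) \<Rightarrow> ('v \<Rightarrow> 'v \<Rightarrow> real) \<Rightarrow> bool" where
  "two_longest_sides_agree V D \<delta> \<longleftrightarrow>
     (\<forall>i j. D i j = D j i) \<and> (\<forall>i j. \<delta> i j = \<delta> j i) \<and>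
     (\<forall>i\<in>V. \<forall>j\<in>V. \<forall>k\<in>V. i \<noteq> j \<longrightarrow> j \<noteq> k \<longrightarrow> i \<noteq> k \<longrightarrow>
        \<delta> i j \<le> \<delta> j k \<longrightarrow> \<delta> j k \<le> \<delta> i k \<longrightarrow> D j k = D i k)"

text \<open>
  A tie would allow the three sides to be sorted in a way that puts the odd-coloured side among the
  two longest.
\<close>

lemma odd_side_strictly_shortest:
  assumes agree: "two_longest_sides_agree V D \<delta>"
    and V: "i \<in> V" "j \<in> V" "k \<in> V" "i \<noteq> j" "j \<noteq> k" "i \<noteq> k"
    and odd: "D i j \<noteq> D j k" "D i j \<noteq> D i k"
  shows "\<delta> i j < \<delta> j k" "\<delta> i j < \<delta> i k"
proof -
  have *: "\<not> (\<delta> j k \<le> \<delta> i j \<and> \<delta> i j \<le> \<delta> i k)" "\<not> (\<delta> i k \<le> \<delta> i j \<and> \<delta> i j \<le> \<delta> j k)"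
    "\<not> (\<delta> j k \<le> \<delta> i k \<and> \<delta> i k \<le> \<delta> i j)" "\<not> (\<delta> i k \<le> \<delta> j k \<and> \<delta> j k \<le> \<delta> i j)"
    using agree V odd unfolding two_longest_sides_agree_def by metis+
  show "\<delta> i j < \<delta> j k" using * by linarith
  show "\<delta> i j < \<delta> i k" using * by linarith
qed

text \<open>
  Call an edge special if its colour is not that of the longest edge \<open>ab\<close>. The hypothesis \<open>conn\<close>
  says that special edges lead from \<open>a\<close> to \<open>b\<close>. A shortest such path with at least three edges
  contains a path \<open>a, u, x, y\<close> whose chords all have the colour of \<open>ab\<close>. In each of its four
  triangles some side is strictly shorter than another, and these inequalities form a cycle. So the
  path has length 2, and then \<open>ab\<close> is the odd side of a triangle, hence not longest.
\<close>

lemma colouring_contradiction: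
  assumes agree: "two_longest_sides_agree V D \<delta>"
    and ab: "a \<in> V" "b \<in> V" "a \<noteq> b"
    and max: "\<And>i j. i \<in> V \<Longrightarrow> j \<in> V \<Longrightarrow> \<delta> i j \<le> \<delta> a b"
    and conn: "\<And>C. a \<in> C \<Longrightarrow> C \<subseteq> V \<Longrightarrow>
       (\<And>x y. x \<in> C \<Longrightarrow> y \<in> V \<Longrightarrow> x \<noteq> y \<Longrightarrow> D x y \<noteq> D a b \<Longrightarrow> y \<in> C) \<Longrightarrow> b \<in> C"
  shows False
proof -
  note strict = odd_side_strictly_shortest[OF agree]
  have D: "D i j = D j i" and \<delta>: "\<delta> i j = \<delta> j i" for i j
    using agree by (auto simp: two_longest_sides_agree_def)
  define L1 where "L1 = {v \<in> V. v \<noteq> a \<and> D a v \<noteq> D a b}"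
  define L2 where "L2 = {v \<in> V. \<exists>x\<in>L1. x \<noteq> v \<and> D x v \<noteq> D a b}"
  \<comment> \<open>the vertices at distance one from \<open>a\<close> along special edges, and those one more edge away\<close>
  have "b \<in> {a} \<union> L1 \<union> L2"
  proof (rule conn)
    show "{a} \<union> L1 \<union> L2 \<subseteq> V" using ab by (auto simp: L1_def L2_def)
    fix x y assume x: "x \<in> {a} \<union> L1 \<union> L2" and y: "y \<in> V" "x \<noteq> y" "D x y \<noteq> D a b"
    show "y \<in> {a} \<union> L1 \<union> L2"
    proof (rule ccontr)
      assume n: "y \<notin> {a} \<union> L1 \<union> L2"
      then have xn: "x \<noteq> a" "x \<notin> L1" using y by (auto simp: L1_def L2_def)
      with x obtain u where u: "u \<in> L1" "u \<noteq> x" "D u x \<noteq> D a b" by (auto simp: L2_def)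
      have V: "x \<in> V" "u \<in> V" using x u xn by (auto simp: L1_def L2_def)
      have c: "D a u \<noteq> D a b" "D a x = D a b" "D a y = D a b" "D u y = D a b"
        "u \<noteq> a" "y \<noteq> a" "y \<noteq> u"
        using u xn n V y by (auto simp: L1_def L2_def)
      have 1: "\<delta> a x < \<delta> a u" 
        using strict(2)[where i = a and j = x and k = u] c u V ab xn D \<delta> by metis
      have 2: "\<delta> a u < \<delta> u y"
        using strict(1)[where i = a and j = u and k = y] c u V ab xn y D \<delta> by metis
      have 3: "\<delta> u y < \<delta> x y"
        using strict(1)[where i = u and j = y and k = x] c u V ab xn y D \<delta> by metis
      have 4: "\<delta> x y < \<delta> a x"
        using strict(1)[where i = y and j = x and k = a] c u V ab xn y D \<delta> by metis
      show False using 1 2 3 4 by linarith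
    qed
  qed auto
  then have "b \<in> L2" using ab by (auto simp: L1_def)
  then obtain u where u: "u \<in> V" "u \<noteq> a" "D a u \<noteq> D a b" "u \<noteq> b" "D u b \<noteq> D a b"
    by (auto simp: L1_def L2_def)
  then have "\<delta> a b < \<delta> b u"
    using strict(1)[where i = a and j = b and k = u] ab D by metis
  with max[of b u] ab u show False by force
qed

section \<open>Cyclically permuted zeros on a strip\<close>

definition turn :: "int \<Rightarrow> complex" where
  "turn k = of_int k * (2 * of_real pi * \<i>)"

lemma turn_add: "turn (j + k) = turn j + turn k"
  and turn_diff: "turn (j - k) = turn j - turn k"
  and turn_minus: "turn (- k) = - turn k"
  and turn_0 [simp]: "turn 0 = 0"
  and turn_eq_iff [simp]: "turn j = turn k \<longleftrightarrow> j = k"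
  and Re_turn [simp]: "Re (turn k) = 0"
  by (auto simp: turn_def algebra_simps)

lemma exp_turn [simp]: "exp (turn k) = 1"
  unfolding turn_def exp_eq_1 by auto

lemma exp_2pi_Ints:
  assumes "z \<in> \<int>" shows "exp (2 * of_real pi * \<i> * z) = 1"
proof -
  obtain m where "z = of_int m" using assms by (rule Ints_cases)
  then have "2 * of_real pi * \<i> * z = turn m" by (simp add: turn_def)
  then show ?thesis by simp
qed

lemma exp_add_turn [simp]: "exp (s + turn k) = exp s" "exp (s - turn k) = exp s"
  by (simp_all add: exp_add exp_diff)

lemma exp_eq_turn: "exp x = exp y \<longleftrightarrow> (\<exists>k. x = y + turn k)"
  unfolding exp_eq turn_def by (simp add: mult_ac)

text \<open>
  The difference is continuous and takes its values in a discrete set.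
\<close>

lemma logs_differ_by_turn:
  assumes "connected S" "continuous_on S A" "continuous_on S B"
    and eq: "\<And>s. s \<in> S \<Longrightarrow> exp (A s) = exp (B s)"
  obtains k :: int where "\<And>s. s \<in> S \<Longrightarrow> A s = B s + turn k"
proof -
  have k: "\<exists>k. A s - B s = turn k" if "s \<in> S" for s
    using eq[OF that] unfolding exp_eq_turn by (metis add_diff_cancel_left')
  have "(\<lambda>s. A s - B s) constant_on S"
  proof (rule continuous_discrete_range_constant[OF assms(1)])
    show "continuous_on S (\<lambda>s. A s - B s)" using assms by (intro continuous_intros)
    fix x assume x: "x \<in> S"
    show "\<exists>e>0. \<forall>y. y \<in> S \<and> A y - B y \<noteq> A x - B x \<longrightarrow> e \<le> norm (A y - B y - (A x - B x))"
    proof (intro exI[of _ 1] conjI allI impI)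
      fix y assume y: "y \<in> S \<and> A y - B y \<noteq> A x - B x"
      obtain j k where jk: "A x - B x = turn j" "A y - B y = turn k" using k[of x] k[of y] x y by blast
      with y have "1 \<le> \<bar>real_of_int (k - j)\<bar>" by auto
      moreover have "1 \<le> 2 * pi" using pi_gt3 by simp
      ultimately have "1 * 1 \<le> \<bar>real_of_int (k - j)\<bar> * (2 * pi)" by (intro mult_mono) auto
      also have "\<dots> = norm (turn (k - j))" by (simp add: turn_def norm_mult del: of_int_diff)
      finally show "1 \<le> norm (A y - B y - (A x - B x))" by (simp add: jk turn_diff)
    qed auto
  qed
  then obtain c where c: "\<And>s. s \<in> S \<Longrightarrow> A s - B s = c" by (auto simp: constant_on_def)
  show ?thesis
  proof (cases "S = {}")
    case False
    then obtain s where "s \<in> S" by auto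
    then obtain k where "c = turn k" using c k[of s] by auto
    with c show ?thesis by (intro that[of k]) (simp add: diff_eq_eq add.commute)
  next
    case True
    then show ?thesis by (intro that[of 0]) simp
  qed
qed

lemma convex_holomorphic_log:
  assumes "convex S" "f holomorphic_on S" "\<And>s. s \<in> S \<Longrightarrow> f s \<noteq> 0"
  obtains g where "g holomorphic_on S" "\<And>s. s \<in> S \<Longrightarrow> f s = exp (g s)"
proof (rule contractible_imp_holomorphic_log)
  show "f holomorphic_on S" "contractible S"
    using assms convex_imp_contractible by auto
  show "\<And>s. s \<in> S \<Longrightarrow> f s \<noteq> 0" by (rule assms(3))
qed (rule that)

text \<open>
  The strip \<open>S\<close> lies over the annulus, and the functions \<open>s \<mapsto> P (s + turn j)\<close> are the zeros of
  the quasipolynomial. The assumption \<open>S_wide\<close> is the condition on the conformal module; it says that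
  \<open>S\<close> contains the vertical strip around the line \<open>Re s = x0\<close> that corresponds to the strip
  \<open>\<bar>Im z\<bar> < \<pi> / ln 2\<close> under \<open>s = x0 + turn n * z\<close>.
\<close>

locale cyclic_roots =
  fixes S :: "complex set" and P :: "complex \<Rightarrow> complex" and n :: nat and x0 :: real
  assumes prime: "prime n"
    and S_convex: "convex S" and S_open: "open S"
    and S_shift: "\<And>s t. s \<in> S \<Longrightarrow> Re s = Re t \<Longrightarrow> t \<in> S"
    and S_wide: "\<And>s. \<bar>Re s - x0\<bar> < 2 * pi\<^sup>2 * n / ln 2 \<Longrightarrow> s \<in> S"
    and P_hol: "P holomorphic_on S"
    and P_eq_iff: "\<And>s i j. s \<in> S \<Longrightarrow> P (s + turn i) = P (s + turn j) \<longleftrightarrow> [i = j] (mod int n)"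
begin

lemma n2: "2 \<le> n" and npos: "0 < n"
  using prime_ge_2_nat[OF prime] by auto

lemma S_turn [simp]: "s + turn k \<in> S \<longleftrightarrow> s \<in> S" "s - turn k \<in> S \<longleftrightarrow> s \<in> S"
  by (rule iffI; erule S_shift; simp)+

lemma S_connected: "connected S" using S_convex by (rule convex_connected)

lemma x0_S: "of_real x0 \<in> S" using npos by (intro S_wide) auto

lemma P_hol_turn: "(\<lambda>s. P (s + turn k)) holomorphic_on S"
  by (rule holomorphic_on_compose_gen[OF _ P_hol, of "\<lambda>s. s + turn k", unfolded o_def])
     (auto intro!: holomorphic_intros)

lemma ex_difference_log:
  "\<exists>L. \<forall>k. \<not> int n dvd k \<longrightarrow> L k holomorphic_on S \<and>
     (\<forall>s\<in>S. P s - P (s + turn k) = exp (L k s))"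
proof -
  have "\<exists>L. \<not> int n dvd k \<longrightarrow> L holomorphic_on S \<and>
     (\<forall>s\<in>S. P s - P (s + turn k) = exp (L s))" for k
  proof (cases "int n dvd k")
    case False
    have "P s - P (s + turn k) \<noteq> 0" if "s \<in> S" for s
      using P_eq_iff[OF that, of 0 k] False by (simp add: cong_iff_dvd_diff)
    moreover have "(\<lambda>s. P s - P (s + turn k)) holomorphic_on S"
      by (intro holomorphic_intros P_hol P_hol_turn)
    ultimately obtain g where "g holomorphic_on S" "\<And>s. s \<in> S \<Longrightarrow> P s - P (s + turn k) = exp (g s)"
      using convex_holomorphic_log[OF S_convex, of "\<lambda>s. P s - P (s + turn k)"] by blast
    then show ?thesis by blast
  qed auto
  then have "\<forall>k. \<exists>L. \<not> int n dvd k \<longrightarrow> L holomorphic_on S \<and>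
     (\<forall>s\<in>S. P s - P (s + turn k) = exp (L s))" by blast
  then show ?thesis by (rule choice)
qed

definition difference_log where "difference_log = (SOME L. \<forall>k. \<not> int n dvd k \<longrightarrow> L k holomorphic_on S \<and>
     (\<forall>s\<in>S. P s - P (s + turn k) = exp (L k s)))"

lemma difference_log:
  assumes "\<not> int n dvd k"
  shows "difference_log k holomorphic_on S" and "s \<in> S \<Longrightarrow> exp (difference_log k s) = P s - P (s + turn k)"
proof -
  have "\<forall>k. \<not> int n dvd k \<longrightarrow> difference_log k holomorphic_on S \<and> (\<forall>s\<in>S. P s - P (s + turn k) = exp (difference_log k s))"
    unfolding difference_log_def by (rule someI_ex[OF ex_difference_log])
  with assms show "difference_log k holomorphic_on S" and "s \<in> S \<Longrightarrow> exp (difference_log k s) = P s - P (s + turn k)" by auto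
qed

lemma difference_log_turn_hol: "\<not> int n dvd k \<Longrightarrow> (\<lambda>s. difference_log k (s + turn i)) holomorphic_on S"
  by (rule holomorphic_on_compose_gen[OF _ difference_log(1), of "\<lambda>s. s + turn i", unfolded o_def])
     (auto intro!: holomorphic_intros)

lemma difference_log_turn_cont: "\<not> int n dvd k \<Longrightarrow> continuous_on S (\<lambda>s. difference_log k (s + turn i))"
  using difference_log_turn_hol holomorphic_on_imp_continuous_on by blast

lemma difference_log_cont: "\<not> int n dvd k \<Longrightarrow> continuous_on S (difference_log k)"
  using difference_log(1) holomorphic_on_imp_continuous_on by blast

lemma exp_difference_log_turn: "\<not> int n dvd k \<Longrightarrow> s \<in> S \<Longrightarrow> exp (difference_log k (s + turn i)) = P (s + turn i) - P (s + turn (i + k))"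
  using difference_log(2)[of k "s + turn i"] by (simp add: turn_add add.assoc)

lemma P_period: "s \<in> S \<Longrightarrow> [i = j] (mod int n) \<Longrightarrow> P (s + turn i) = P (s + turn j)"
  using P_eq_iff by blast

lemma ex_winding: "\<exists>d. \<forall>k. \<not> int n dvd k \<longrightarrow> (\<forall>s\<in>S. difference_log k (s + turn n) = difference_log k s + turn (d k))"
proof -
  have "\<exists>d. \<forall>s\<in>S. difference_log k (s + turn n) = difference_log k s + turn d" if k: "\<not> int n dvd k" for k
  proof -
    have "exp (difference_log k (s + turn n)) = exp (difference_log k s)" if s: "s \<in> S" for s
      unfolding exp_difference_log_turn[OF k s] difference_log(2)[OF k s]
      using P_period[OF s, of n 0] P_period[OF s, of "n + k" k] by (simp add: cong_def)
    then obtain d where "\<And>s. s \<in> S \<Longrightarrow> difference_log k (s + turn n) = difference_log k s + turn d"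
      using logs_differ_by_turn[OF S_connected difference_log_turn_cont[OF k] difference_log_cont[OF k]] by blast
    then show ?thesis by blast
  qed
  then have "\<forall>k. \<exists>d. \<not> int n dvd k \<longrightarrow> (\<forall>s\<in>S. difference_log k (s + turn n) = difference_log k s + turn d)" by blast
  then show ?thesis by (rule choice)
qed

definition winding where "winding =
     (SOME d. \<forall>k. \<not> int n dvd k \<longrightarrow> (\<forall>s\<in>S. difference_log k (s + turn n) = difference_log k s + turn (d k)))"

lemma winding: "\<not> int n dvd k \<Longrightarrow> s \<in> S \<Longrightarrow> difference_log k (s + turn n) = difference_log k s + turn (winding k)"
proof -
  have "\<forall>k. \<not> int n dvd k \<longrightarrow> (\<forall>s\<in>S. difference_log k (s + turn n) = difference_log k s + turn (winding k))"
    unfolding winding_def by (rule someI_ex[OF ex_winding])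
  then show "\<not> int n dvd k \<Longrightarrow> s \<in> S \<Longrightarrow> difference_log k (s + turn n) = difference_log k s + turn (winding k)" by blast
qed

lemma winding_cong:
  assumes k: "\<not> int n dvd k" and c: "[k = k'] (mod int n)"
  shows "winding k = winding k'"
proof -
  have k': "\<not> int n dvd k'" using k c by (metis cong_dvd_iff)
  have "exp (difference_log k s) = exp (difference_log k' s)" if s: "s \<in> S" for s
    using difference_log(2)[OF k s] difference_log(2)[OF k' s] P_period[OF s c] by simp
  then obtain m where m: "\<And>s. s \<in> S \<Longrightarrow> difference_log k s = difference_log k' s + turn m"
    using logs_differ_by_turn[OF S_connected difference_log_cont[OF k] difference_log_cont[OF k']] by blast
  have "turn (winding k) = turn (winding k')"
    using winding[OF k x0_S] winding[OF k' x0_S] m[OF x0_S] m[of "of_real x0 + turn n"] x0_S by simp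
  then show ?thesis by simp
qed

text \<open>
  The additional \<open>\<pi>i\<close> comes from exchanging the two zeros. It produces the odd numbers
  by which the divisibility of the common winding number is refuted.
\<close>

lemma difference_log_minus:
  assumes k: "\<not> int n dvd k"
  obtains c where "\<And>s. s \<in> S \<Longrightarrow> difference_log (- k) s = difference_log k (s + turn (- k)) + \<i> * of_real pi + turn c"
proof -
  have k': "\<not> int n dvd - k" using k by simp
  have "exp (difference_log (-k) s) = exp (difference_log k (s + turn (- k)) + \<i> * of_real pi)" if s: "s \<in> S" for s
    using difference_log(2)[OF k' s] exp_difference_log_turn[OF k s, of "-k"] by (simp add: exp_add)
  then obtain c where "\<And>s. s \<in> S \<Longrightarrow> difference_log (- k) s = difference_log k (s + turn (- k)) + \<i> * of_real pi + turn c"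
    using logs_differ_by_turn[OF S_connected difference_log_cont[OF k'] continuous_on_add[OF difference_log_turn_cont[OF k] continuous_on_const]]
    by blast
  then show ?thesis by (rule that)
qed

lemma winding_minus: assumes k: "\<not> int n dvd k" shows "winding (- k) = winding k"
proof -
  obtain c where c: "\<And>s. s \<in> S \<Longrightarrow> difference_log (- k) s = difference_log k (s + turn (- k)) + \<i> * of_real pi + turn c"
    using difference_log_minus[OF k] by blast
  let ?s = "of_real x0"
  have "difference_log (-k) (?s + turn n) = difference_log k ((?s + turn (-k)) + turn n) + \<i> * of_real pi + turn c"
    using c[of "?s + turn n"] x0_S by (simp add: algebra_simps)
  also have "\<dots> = difference_log (-k) ?s + turn (winding k)"
    using winding[OF k, of "?s + turn (-k)"] c[OF x0_S] x0_S by simp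
  finally show ?thesis using winding[of "-k" ?s] k x0_S by simp
qed

lemma S_strip:
  assumes "z \<in> strip" "Re s = x0"
  shows "s + turn n * z \<in> S"
proof (rule S_wide)
  have "\<bar>Re (s + turn n * z) - x0\<bar> = 2 * pi * n * \<bar>Im z\<bar>"
    using assms by (simp add: turn_def abs_mult)
  also have "\<dots> < 2 * pi * n * (pi / ln 2)"
    using assms npos by (intro mult_strict_left_mono) (auto simp: strip_def)
  also have "\<dots> = 2 * pi\<^sup>2 * n / ln 2" by (simp add: power2_eq_square)
  finally show "\<bar>Re (s + turn n * z) - x0\<bar> < 2 * pi\<^sup>2 * n / ln 2" .
qed

lemma strip_hol:
  assumes "F holomorphic_on S" "Re s = x0"
  shows "(\<lambda>z. F (s + turn n * z)) holomorphic_on strip"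
  by (rule holomorphic_on_compose_gen[OF _ assms(1), of "\<lambda>z. s + turn n * z", unfolded o_def])
     (use S_strip assms in \<open>auto intro!: holomorphic_intros\<close>)

text \<open>
  Let \<open>y\<close> be the quotient of the second longest side by the longest one. Then \<open>\<bar>y\<bar> \<le> 1\<close>, and
  \<open>1 - y\<close> is the quotient of the shortest by the longest, so \<open>\<bar>1 - y\<bar> \<le> \<bar>y\<bar>\<close>, which means
  \<open>Re y \<ge> 1/2\<close>. The increment of the logarithm of \<open>y\<close> over a period is the difference of the
  two winding numbers.
\<close>

lemma two_longest_sides_same_winding:
  assumes s: "Re s = x0"
    and ne: "\<not> [i = j] (mod int n)" "\<not> [j = k] (mod int n)" "\<not> [i = k] (mod int n)"
    and le: "cmod (P (s + turn i) - P (s + turn j)) \<le> cmod (P (s + turn j) - P (s + turn k))"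
      "cmod (P (s + turn j) - P (s + turn k)) \<le> cmod (P (s + turn i) - P (s + turn k))"
  shows "winding (k - j) = winding (k - i)"
proof -
  have kj: "\<not> int n dvd k - j" and ki: "\<not> int n dvd k - i"
    using ne by (metis cong_iff_dvd_diff cong_sym)+
  have sS: "s \<in> S" using S_shift[OF x0_S] s by simp
  define Y where "Y = (\<lambda>s. (difference_log (k - j) (s + turn j) - difference_log (k - i) (s + turn i)) / (2 * of_real pi * \<i>))"
  have expY: "exp (2 * of_real pi * \<i> * Y s) = (P (s + turn j) - P (s + turn k)) / (P (s + turn i) - P (s + turn k))"
    if "s \<in> S" for s
    using exp_difference_log_turn[OF kj that, of j] exp_difference_log_turn[OF ki that, of i] by (simp add: Y_def exp_diff)
  have nz: "P (s + turn i) - P (s + turn k) \<noteq> 0" if "s \<in> S" for s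
    using P_eq_iff[OF that] ne by simp
  have om: "Y s \<notin> \<int>" if sS: "s \<in> S" for s
  proof
    assume "Y s \<in> \<int>"
    then have "exp (2 * of_real pi * \<i> * Y s) = 1" by (rule exp_2pi_Ints)
    then have "P (s + turn j) = P (s + turn i)" using expY[OF sS] nz[OF sS] by (simp add: field_simps)
    then show False using P_eq_iff[OF sS] ne(1) cong_sym by blast
  qed
  define G where "G = (\<lambda>z. Y (s + turn n * z))"
  have Yh: "Y holomorphic_on S"
    unfolding Y_def by (intro holomorphic_intros difference_log_turn_hol kj ki) auto
  define y where "y = exp (2 * of_real pi * \<i> * Y s)"
  have ye: "y = (P (s + turn j) - P (s + turn k)) / (P (s + turn i) - P (s + turn k))"
    using expY[OF sS] by (simp add: y_def)
  have y1: "cmod y \<le> 1" using le(2) nz[OF sS] by (simp add: ye norm_divide)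
  have "1 - y = (P (s + turn i) - P (s + turn j)) / (P (s + turn i) - P (s + turn k))"
    using nz[OF sS] by (simp add: ye field_simps)
  then have "cmod (1 - y) \<le> cmod y"
    using le(1) by (simp add: ye norm_divide divide_right_mono)
  then have "(cmod (1 - y))\<^sup>2 \<le> (cmod y)\<^sup>2" by (intro power_mono) auto
  then have y2: "1/2 \<le> Re y" unfolding cmod_power2 by (simp add: power2_eq_square algebra_simps)
  have "winding (k - j) - winding (k - i) = 0"
  proof (rule strip_winding_eq_0[where Y = G and s = 0 and y = y])
    show "G holomorphic_on strip" unfolding G_def by (rule strip_hol[OF Yh s])
    show "\<And>z. z \<in> strip \<Longrightarrow> G z \<notin> \<int>" unfolding G_def using om S_strip s by blast
    show "y = exp (2 * of_real pi * \<i> * G (of_real 0))" by (simp add: y_def G_def)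
    define t where "t = s + turn n * of_real (0 - 1/2)"
    have tS: "t \<in> S" unfolding t_def by (rule S_strip[OF of_real_in_strip s])
    have "G (of_real (0 + 1/2)) = Y (t + turn n)" by (simp add: G_def t_def algebra_simps)
    also have "\<dots> = (difference_log (k - j) ((t + turn j) + turn n) - difference_log (k - i) ((t + turn i) + turn n)) / (2 * of_real pi * \<i>)"
      by (simp add: Y_def add_ac)
    also have "\<dots> = (difference_log (k - j) (t + turn j) + turn (winding (k - j)) - (difference_log (k - i) (t + turn i) + turn (winding (k - i)))) / (2 * of_real pi * \<i>)"
      using winding[OF kj, of "t + turn j"] winding[OF ki, of "t + turn i"] tS by simp
    also have "\<dots> = Y t + (turn (winding (k - j)) - turn (winding (k - i))) / (2 * of_real pi * \<i>)"
      by (simp add: Y_def diff_divide_distrib add_divide_distrib)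
    also have "\<dots> = Y t + of_int (winding (k - j) - winding (k - i))"
      by (simp add: turn_def flip: left_diff_distrib)
    finally show "G (of_real (0 + 1/2)) = G (of_real (0 - 1/2)) + of_int (winding (k - j) - winding (k - i))"
      by (simp add: G_def t_def)
  qed (use y1 y2 in auto)
  then show ?thesis by simp
qed

end

section \<open>The common winding number\<close>

context cyclic_roots
begin

abbreviation side :: "int \<Rightarrow> int \<Rightarrow> real" where
  "side i j \<equiv> cmod (P (of_real x0 + turn i) - P (of_real x0 + turn j))"

lemma side_mod: "side (i mod int n) (j mod int n) = side i j"
  using P_period[OF x0_S, of "i mod int n" i] P_period[OF x0_S, of "j mod int n" j] by (simp add: cong_def)

lemma ex_longest_side:
  "\<exists>a b. a \<in> {0..<int n} \<and> b \<in> {0..<int n} \<and> a \<noteq> b \<and> (\<forall>i j. side i j \<le> side a b)"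
proof -
  let ?V = "{0..<int n}"
  define M where "M = (\<lambda>p. side (fst p) (snd p)) ` (?V \<times> ?V)"
  have fin: "finite M" by (simp add: M_def)
  have "(0, 0) \<in> ?V \<times> ?V" using npos by auto
  then have "M \<noteq> {}" unfolding M_def by blast
  with fin have "Max M \<in> M" by (rule Max_in)
  then obtain p where p: "Max M = side (fst p) (snd p)" "p \<in> ?V \<times> ?V"
    unfolding M_def by (rule imageE)
  define a b where "a = fst p" and "b = snd p"
  have ab: "a \<in> ?V" "b \<in> ?V" "side a b = Max M"
    using p by (auto simp: a_def b_def)
  have max: "side i j \<le> side a b" for i j
  proof -
    have "(i mod int n, j mod int n) \<in> ?V \<times> ?V" using npos by simp
    then have "side (i mod int n) (j mod int n) \<in> M" unfolding M_def by force
    then have "side (i mod int n) (j mod int n) \<le> Max M" by (rule Max_ge[OF fin])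
    then show ?thesis unfolding side_mod ab(3) .
  qed
  have "\<not> [0 = 1] (mod int n)" using n2 by (simp add: cong_def)
  then have "0 < side 0 1" using P_eq_iff[OF x0_S, of 0 1] by simp
  then have "a \<noteq> b" using max[of 0 1] by auto
  with ab max show ?thesis by blast
qed

text \<open>
  Edges with the winding number \<open>winding k\<close> join \<open>x\<close> to \<open>x + k\<close>. As \<open>n\<close> is prime, repeated steps by
  \<open>k\<close> reach every residue, so these edges connect \<open>a\<close> to \<open>b\<close>. If their colour
  were not that of the longest edge \<open>ab\<close>, the colouring would be impossible.
\<close>

lemma all_windings_equal:
  assumes ab: "a \<in> {0..<int n}" "b \<in> {0..<int n}" "a \<noteq> b" and max: "\<And>i j. side i j \<le> side a b"
    and k: "\<not> int n dvd k"
  shows "winding k = winding (b - a)"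
proof (rule ccontr)
  assume ne: "winding k \<noteq> winding (b - a)"
  let ?V = "{0..<int n}"
  \<comment> \<open>the value 0 on the diagonal only serves to make the colouring symmetric there\<close>
  define D where "D = (\<lambda>i j. if int n dvd j - i then 0 else winding (j - i))"
  have incong: "\<not> int n dvd j - i" if "i \<in> ?V" "j \<in> ?V" "i \<noteq> j" for i j
    using that by (metis atLeastLessThan_iff cong_iff_dvd_diff cong_less_imp_eq_int)
  show False
  proof (rule colouring_contradiction[of ?V D side a b])
    have sym: "D i j = D j i" for i j
      using winding_minus[of "j - i"] by (auto simp: D_def dvd_diff_commute)
    have long: "D j k = D i k" if "i \<in> ?V" "j \<in> ?V" "k \<in> ?V" "i \<noteq> j" "j \<noteq> k" "i \<noteq> k"
      "side i j \<le> side j k" "side j k \<le> side i k" for i j k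
    proof -
      have "winding (k - j) = winding (k - i)"
        by (rule two_longest_sides_same_winding[OF _ _ _ _ that(7,8)])
           (use incong[of i j] incong[of j k] incong[of i k] that in \<open>auto simp: cong_iff_dvd_diff dvd_diff_commute\<close>)
      then show ?thesis using incong that by (simp add: D_def)
    qed
    show "two_longest_sides_agree ?V D side"
      unfolding two_longest_sides_agree_def
      by (intro conjI allI ballI impI sym norm_minus_commute) (rule long; assumption)
    show "b \<in> C" if C: "a \<in> C" "C \<subseteq> ?V"
      and closed: "\<And>x y. x \<in> C \<Longrightarrow> y \<in> ?V \<Longrightarrow> x \<noteq> y \<Longrightarrow> D x y \<noteq> D a b \<Longrightarrow> y \<in> C" for C
    proof -
      have step: "(x + k) mod int n \<in> C" if x: "x \<in> C" for x
      proof -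
        let ?y = "(x + k) mod int n"
        have c: "[?y - x = k] (mod int n)" by (simp add: cong_def mod_simps)
        then have nd: "\<not> int n dvd ?y - x" using k by (metis cong_dvd_iff)
        then have "D x ?y = winding k" using winding_cong[OF nd c] by (simp add: D_def)
        moreover have "D a b = winding (b - a)" using incong[OF ab] by (simp add: D_def)
        ultimately have "D x ?y \<noteq> D a b" using ne by simp
        moreover have "x \<noteq> ?y" using nd by auto
        moreover have "?y \<in> ?V" using npos by simp
        ultimately show ?thesis using closed[OF x] by blast
      qed
      have orbit: "(a + int m * k) mod int n \<in> C" for m
      proof (induction m)
        case 0
        then show ?case using C ab by simp
      next
        case (Suc m)
        have "((a + int m * k) mod int n + k) mod int n = (a + int (Suc m) * k) mod int n"
          by (simp add: mod_simps algebra_simps)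
        with step[OF Suc] show ?case by simp
      qed
      have "coprime (int n) k" using prime k by (intro prime_imp_coprime) auto
      then obtain x where x: "[k * x = 1] (mod int n)"
        using cong_solve_coprime_int[of k "int n"] by (auto simp: coprime_commute)
      define m where "m = nat ((x * (b - a)) mod int n)"
      have "int m = (x * (b - a)) mod int n" using npos by (simp add: m_def)
      then have "[int m * k = (x * (b - a)) * k] (mod int n)" by (simp add: cong_def mod_simps)
      also have "[(x * (b - a)) * k = 1 * (b - a)] (mod int n)"
        using cong_mult[OF x cong_refl[of "b - a"]] by (simp add: mult_ac)
      finally have "[a + int m * k = a + (b - a)] (mod int n)" by (intro cong_add) auto
      then have "(a + int m * k) mod int n = b mod int n" by (simp add: cong_def)
      with orbit[of m] ab show ?thesis by simp
    qed
  qed (use ab max in auto)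
qed

lemma sum_period_shift:
  fixes F :: "int \<Rightarrow> complex"
  assumes F: "\<And>i. F (i + int n) = F i"
  shows "(\<Sum>j<n. F (int j + k)) = (\<Sum>j<n. F (int j))"
proof -
  have per: "F (i + int n * m) = F i" for i m
  proof (induction m arbitrary: i rule: int_induct[where k = 0])
    case (step1 m)
    then show ?case using F[of "i + int n * m"] by (simp add: algebra_simps)
  next
    case (step2 m)
    then show ?case using F[of "i + int n * m - int n"] by (simp add: algebra_simps)
  qed simp
  have Fmod: "F (i mod int n) = F i" for i
    using per[of "i mod int n" "i div int n"] by (simp add: algebra_simps)
  have "(\<Sum>j<n. F (int j + k)) = (\<Sum>j\<in>{0..<int n}. F (j + k))"
    by (rule sum.reindex_bij_witness[of _ nat int]) auto
  also have "\<dots> = (\<Sum>j\<in>{0..<int n}. F j)"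
  proof (rule sum.reindex_bij_witness[of _ "\<lambda>j. (j - k) mod int n" "\<lambda>j. (j + k) mod int n"])
    fix j assume j: "j \<in> {0..<int n}"
    show "((j + k) mod int n - k) mod int n = j" "((j - k) mod int n + k) mod int n = j"
      using j by (simp_all add: mod_diff_left_eq mod_add_left_eq)
    show "(j + k) mod int n \<in> {0..<int n}" "(j - k) mod int n \<in> {0..<int n}" using npos by simp_all
    show "F ((j + k) mod int n) = F (j + k)" by (rule Fmod)
  qed
  also have "\<dots> = (\<Sum>j<n. F (int j))"
    by (rule sum.reindex_bij_witness[of _ int nat]) auto
  finally show ?thesis .
qed

text \<open>
  For two zeros one turn changes the sign of their difference, so one turn adds an odd multiple of \<open>\<pi>i\<close>
  to the logarithm and two turns add an odd multiple of \<open>2\<pi>i\<close>.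
\<close>

lemma winding_not_divisible_2:
  assumes "n = 2"
  shows "\<not> int n dvd winding 1"
proof -
  have k: "\<not> int n dvd 1" using assms by simp
  have "exp (difference_log 1 (s + turn 1)) = exp (difference_log 1 s + \<i> * of_real pi)" if s: "s \<in> S" for s
    using exp_difference_log_turn[OF k s, of 1] difference_log(2)[OF k s] P_period[OF s, of 2 0] assms
    by (simp add: exp_add cong_def)
  then obtain c where c: "\<And>s. s \<in> S \<Longrightarrow> difference_log 1 (s + turn 1) = difference_log 1 s + \<i> * of_real pi + turn c"
    using logs_differ_by_turn[OF S_connected difference_log_turn_cont[OF k] continuous_on_add[OF difference_log_cont[OF k] continuous_on_const]]
    by blast
  let ?s = "of_real x0"
  have "difference_log 1 ?s + turn (winding 1) = difference_log 1 (?s + turn n)" using winding[OF k x0_S] by simp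
  also have "turn (int n) = turn 1 + turn 1" using assms by (simp flip: turn_add)
  also have "difference_log 1 (?s + (turn 1 + turn 1)) = difference_log 1 ?s + (2 * (\<i> * of_real pi) + turn c + turn c)"
    using c[of "?s + turn 1"] c[OF x0_S] x0_S by (simp add: add.assoc)
  also have "2 * (\<i> * of_real pi) = turn 1" by (simp add: turn_def)
  finally have "turn (winding 1) = turn 1 + turn c + turn c" by simp
  then have "turn (winding 1) = turn (1 + c + c)" by (simp only: turn_add)
  then have "winding 1 = 1 + c + c" by simp
  then show ?thesis using assms by simp
qed

text \<open>
  Suppose that the winding number is \<open>n e\<close>. Then \<open>difference_log k s - e s\<close> has period \<open>turn n\<close>, and
  its sum over an orbit does not change under a shift by \<open>turn (- k)\<close>. In the orbit sum of \<open>Q\<close>, the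
  logarithm of \<open>q = (p\<^sub>0 - p\<^sub>-\<^sub>k) / (p\<^sub>0 - p\<^sub>k)\<close>, everything cancels but \<open>n\<close> times an odd multiple
  of \<open>\<pi>i\<close>. Maximality of the side \<open>ab\<close> puts \<open>q\<close> into the lens at one point. For odd \<open>n\<close> the zeros
  \<open>p\<^sub>k\<close> and \<open>p\<^sub>-\<^sub>k\<close> differ, so \<open>q\<close> omits the value 1.
\<close>

lemma winding_not_divisible:
  assumes ab: "a \<in> {0..<int n}" "b \<in> {0..<int n}" "a \<noteq> b" and max: "\<And>i j. side i j \<le> side a b"
    and odd: "odd n"
  shows "\<not> int n dvd winding (b - a)"
proof
  assume dvd: "int n dvd winding (b - a)"
  then obtain e where e: "winding (b - a) = int n * e" by auto
  define k where "k = b - a"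
  have k: "\<not> int n dvd k" unfolding k_def
    using ab by (metis atLeastLessThan_iff cong_iff_dvd_diff cong_less_imp_eq_int)
  then have k': "\<not> int n dvd - k" by simp
  have dk: "winding k = int n * e" using e by (simp add: k_def)
  then have dk': "winding (- k) = int n * e" using winding_minus[OF k] by simp
  obtain c where c: "\<And>s. s \<in> S \<Longrightarrow> difference_log (- k) s = difference_log k (s + turn (- k)) + \<i> * of_real pi + turn c"
    using difference_log_minus[OF k] by blast
  define Q where "Q = (\<lambda>s. difference_log (- k) s - difference_log k s)"
  have expQ: "exp (Q s) = (P s - P (s + turn (- k))) / (P s - P (s + turn k))" if "s \<in> S" for s
    using difference_log(2)[OF k that] difference_log(2)[OF k' that] by (simp add: Q_def exp_diff)
  have Qper: "Q (s + turn n) = Q s" if "s \<in> S" for s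
    using winding[OF k that] winding[OF k' that] dk dk' by (simp add: Q_def)
  have Qh: "Q holomorphic_on S" unfolding Q_def by (intro holomorphic_intros difference_log k k')
  define s1 where "s1 = of_real x0 + turn a"
  have s1: "s1 \<in> S" "Re s1 = x0" using x0_S by (auto simp: s1_def)
  define F where "F = (\<lambda>i. difference_log k (s1 + turn i) - of_int e * turn i)"
  have Fper: "F (i + int n) = F i" for i
    using winding[OF k, of "s1 + turn i"] s1 by (simp add: F_def dk turn_add add.assoc) (simp add: turn_def algebra_simps)
  define C where "C = \<i> * of_real pi + turn c - of_int e * turn k"
  have Q: "Q (s1 + turn j) = F (j + - k) - F j + C" for j
    using c[of "s1 + turn j"] s1
    by (simp add: Q_def F_def C_def turn_diff turn_minus algebra_simps)
  have "(\<Sum>j<n. Q (s1 + turn j)) = (\<Sum>j<n. F (int j + - k)) - (\<Sum>j<n. F (int j)) + of_nat n * C"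
    unfolding Q sum.distrib sum_subtractf by simp
  also have "(\<Sum>j<n. F (int j + - k)) = (\<Sum>j<n. F (int j))"
    by (rule sum_period_shift[where F = F]) (rule Fper)
  finally have sumQ: "(\<Sum>j<n. Q (s1 + turn j)) = of_nat n * C" by simp
  define G where "G = (\<lambda>z. Q (s1 + turn n * z) / (2 * of_real pi * \<i>))"
  have nz: "P s - P (s + turn k) \<noteq> 0" if "s \<in> S" for s
    using difference_log(2)[OF k that] exp_not_eq_zero by metis
  have "even (1 + 2 * c - 2 * e * k)"
  proof (rule strip_orbit_mean_not_half_odd[where G = G and s = 0 and n = n and q = "exp (Q s1)"])
    have "(\<lambda>s. Q s / (2 * of_real pi * \<i>)) holomorphic_on S" by (intro holomorphic_intros Qh) auto
    then show "G holomorphic_on strip" unfolding G_def by (rule strip_hol) (rule s1)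
    show "G z \<notin> \<int>" if "z \<in> strip" for z
    proof
      let ?s = "s1 + turn n * z"
      have S: "?s \<in> S" using S_strip[OF that s1(2)] .
      assume "G z \<in> \<int>"
      then have "exp (2 * of_real pi * \<i> * G z) = 1" by (rule exp_2pi_Ints)
      then have "exp (Q ?s) = 1" by (simp add: G_def)
      then have "P (?s + turn (- k)) = P (?s + turn k)" using expQ[OF S] nz[OF S] by (simp add: field_simps)
      then have "int n dvd - k - k" using P_eq_iff[OF S] by (simp add: cong_iff_dvd_diff)
      also have "- k - k = - (2 * k)" by simp
      finally have "int n dvd 2 * k" by (simp only: dvd_minus_iff)
      moreover have "coprime (int n) 2" using odd by (simp add: coprime_right_2_iff_odd)
      ultimately show False using k by (simp add: coprime_dvd_mult_right_iff)
    qed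
    show "G (of_real (t + 1)) = G (of_real t)" for t :: real
      using Qper[OF S_strip[of "of_real t" s1]] s1 by (simp add: G_def algebra_simps)
    show "exp (Q s1) = exp (2 * of_real pi * \<i> * G (of_real 0))" by (simp add: G_def)
    have s1k: "s1 + turn (- k) = of_real x0 + turn (a - k)" "s1 + turn k = of_real x0 + turn b"
      by (simp_all add: s1_def turn_minus turn_diff) (simp add: k_def turn_diff)
    have eq: "exp (Q s1) = (P (of_real x0 + turn a) - P (of_real x0 + turn (a - k))) / 
        (P (of_real x0 + turn a) - P (of_real x0 + turn b))"
      using expQ[OF s1(1)] unfolding s1k unfolding s1_def .
    have nz1: "P (of_real x0 + turn a) - P (of_real x0 + turn b) \<noteq> 0"
      using nz[OF s1(1)] unfolding s1k unfolding s1_def .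
    show "cmod (exp (Q s1)) \<le> 1"
      unfolding eq using max[of a "a - k"] nz1 by (simp add: norm_divide)
    have eq': "1 - exp (Q s1) = (P (of_real x0 + turn (a - k)) - P (of_real x0 + turn b)) / 
        (P (of_real x0 + turn a) - P (of_real x0 + turn b))"
      unfolding eq using nz1 by (simp add: field_simps)
    show "cmod (1 - exp (Q s1)) \<le> 1"
      unfolding eq' using max[of "a - k" b] nz1 by (simp add: norm_divide)
    show "0 < n" by (rule npos)
    have orbit: "turn n * of_real (0 + real j / real n) = turn j" for j
      using npos by (simp add: turn_def)
    have C: "C = of_int (1 + 2 * c - 2 * e * k) * (of_real pi * \<i>)"
      unfolding C_def turn_def by (simp add: algebra_simps)
    have "(\<Sum>j<n. G (of_real (0 + real j / real n))) = of_nat n * C / (2 * of_real pi * \<i>)"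
      unfolding G_def orbit sumQ[symmetric] by (rule sum_divide_distrib[symmetric])
    also have "\<dots> = of_nat n * of_int (1 + 2 * c - 2 * e * k) / 2"
    proof -
      have "z * w / (2 * w) = z / 2" if "w \<noteq> 0" for z w :: complex using that by simp
      from this[of "of_real pi * \<i>" "of_nat n * of_int (1 + 2 * c - 2 * e * k)"] show ?thesis
        unfolding C by (simp only: mult.assoc) simp
    qed
    finally show "(\<Sum>j<n. G (of_real (0 + real j / real n))) = of_nat n * of_int (1 + 2 * c - 2 * e * k) / 2" .
  qed
  then show False by simp
qed

lemma common_winding_number:
  obtains w where "\<And>k. \<not> int n dvd k \<Longrightarrow> winding k = w" "\<not> int n dvd w"
proof -
  obtain a b where ab: "a \<in> {0..<int n}" "b \<in> {0..<int n}" "a \<noteq> b" and max: "\<And>i j. side i j \<le> side a b"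
    using ex_longest_side by metis
  note all = all_windings_equal[OF ab max]
  show ?thesis
  proof (cases "n = 2")
    case True
    have "\<not> int n dvd 1" using True by simp
    with winding_not_divisible_2[OF True] all[of 1] all show ?thesis by (intro that[of "winding (b - a)"]) auto
  next
    case False
    then have "odd n" using prime by (metis prime_odd_nat n2 le_neq_implies_less)
    with winding_not_divisible[OF ab max] all show ?thesis by (intro that[of "winding (b - a)"]) auto
  qed
qed

end

section \<open>Continuous and holomorphic zeros of quasipolynomials\<close>

lemma degree_root_product: "degree (\<Prod>z\<in>A. [:- g z, 1:] :: complex poly) = card A"
  and lead_coeff_root_product: "lead_coeff (\<Prod>z\<in>A. [:- g z, 1:] :: complex poly) = 1"
proof -
  show "degree (\<Prod>z\<in>A. [:- g z, 1:] :: complex poly) = card A"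
    by (subst degree_prod_sum_eq) auto
  show "lead_coeff (\<Prod>z\<in>A. [:- g z, 1:] :: complex poly) = 1"
    by (simp add: lead_coeff_prod)
qed

lemma monic_squarefree_roots:
  fixes p :: "complex poly"
  assumes "rsquarefree p" "lead_coeff p = 1"
  shows "p = (\<Prod>z | poly p z = 0. [:- z, 1:])" and "card {z. poly p z = 0} = degree p"
    and "finite {z. poly p z = 0}"
proof -
  show *: "p = (\<Prod>z | poly p z = 0. [:- z, 1:])"
    using complex_poly_decompose_rsquarefree[OF assms(1)] assms(2) by simp
  show "card {z. poly p z = 0} = degree p"
    using degree_root_product[of "\<lambda>z. z" "{z. poly p z = 0}"] * by simp
  have "p \<noteq> 0" using assms by auto
  then show "finite {z. poly p z = 0}" by (rule poly_roots_finite)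
qed

text \<open>
  The modulus of a monic polynomial at \<open>z\<close> is the product of the distances from \<open>z\<close> to its zeros.
  This elementary remark is the source of all continuity statements about zeros below.
\<close>

lemma root_near:
  fixes p :: "complex poly"
  assumes "rsquarefree p" "lead_coeff p = 1" "0 < \<epsilon>" "cmod (poly p z) < \<epsilon> ^ degree p"
  obtains w where "poly p w = 0" "cmod (w - z) < \<epsilon>"
proof (rule ccontr)
  let ?R = "{w. poly p w = 0}"
  note p = monic_squarefree_roots[OF assms(1,2)]
  assume "\<not> thesis"
  then have far: "\<epsilon> \<le> cmod (w - z)" if "w \<in> ?R" for w using that \<open>\<And>w. _ \<Longrightarrow> _ \<Longrightarrow> thesis\<close> by force
  have "\<epsilon> ^ degree p = (\<Prod>w\<in>?R. \<epsilon>)" using p(2) by simp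
  also have "\<dots> \<le> (\<Prod>w\<in>?R. cmod (z - w))"
    using far assms(3) by (intro prod_mono) (auto simp: norm_minus_commute)
  also have "\<dots> = cmod (poly (\<Prod>w\<in>?R. [:- w, 1:]) z)"
    by (simp add: poly_prod prod_norm)
  also have "(\<Prod>w\<in>?R. [:- w, 1:]) = p" using p(1) by simp
  finally show False using assms(4) by simp
qed

lemma quasipolynomial_coeff_continuous:
  assumes "quasipolynomial X n f"
  shows "continuous_on X (\<lambda>x. coeff (f x) j)"
proof -
  consider "j < n" | "j = n" | "n < j" by linarith
  then show ?thesis
  proof cases
    case 2
    then have "coeff (f x) j = 1" if "x \<in> X" for x using assms that by (auto simp: quasipolynomial_def)
    then show ?thesis using continuous_on_cong[of X X "\<lambda>x. coeff (f x) j" "\<lambda>_. 1"] by simp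
  next
    case 3
    then have "coeff (f x) j = 0" if "x \<in> X" for x 
      using assms that by (auto simp: quasipolynomial_def coeff_eq_0)
    then show ?thesis using continuous_on_cong[of X X "\<lambda>x. coeff (f x) j" "\<lambda>_. 0"] by simp
  qed (use assms in \<open>auto simp: quasipolynomial_def\<close>)
qed

lemma quasipolynomial_poly:
  assumes "quasipolynomial X n f" "x \<in> X"
  shows "poly (f x) z = (\<Sum>j\<le>n. coeff (f x) j * z ^ j)"
  using assms by (auto simp: quasipolynomial_def poly_altdef)

lemma quasipolynomial_poly_continuous:
  assumes "quasipolynomial X n f"
  shows "continuous_on X (\<lambda>x. poly (f x) z)"
proof -
  have "continuous_on X (\<lambda>x. \<Sum>j\<le>n. coeff (f x) j * z ^ j)"
    by (intro continuous_intros quasipolynomial_coeff_continuous[OF assms])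
  then show ?thesis
    using quasipolynomial_poly[OF assms] by (subst continuous_on_cong[OF refl]) auto
qed

lemma finite_separation:
  fixes R :: "complex set"
  assumes "finite R"
  obtains \<epsilon> where "0 < \<epsilon>" "\<And>a b. a \<in> R \<Longrightarrow> b \<in> R \<Longrightarrow> a \<noteq> b \<Longrightarrow> 2 * \<epsilon> \<le> dist a b"
proof -
  define M where "M = insert 1 ((\<lambda>(a,b). dist a b) ` {(a,b). a \<in> R \<and> b \<in> R \<and> a \<noteq> b})"
  have "{(a,b). a \<in> R \<and> b \<in> R \<and> a \<noteq> b} \<subseteq> R \<times> R" by auto
  then have fin: "finite M" unfolding M_def using assms by (meson finite.insertI finite_SigmaI finite_imageI finite_subset)
  have "0 < Min M" using fin by (subst Min_gr_iff) (auto simp: M_def)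
  moreover have "Min M \<le> dist a b" if "a \<in> R" "b \<in> R" "a \<noteq> b" for a b
    using fin by (intro Min_le) (use that in \<open>auto simp: M_def intro!: image_eqI[of _ _ "(a,b)"]\<close>)
  ultimately show ?thesis by (intro that[of "Min M / 2"]) auto
qed

definition root_set :: "complex set \<Rightarrow> (complex \<Rightarrow> complex poly) \<Rightarrow> (complex \<times> complex) set" where
  "root_set S F = {(s, z). s \<in> S \<and> poly (F s) z = 0}"

text \<open>
  Put disjoint discs of radius \<open>\<epsilon>\<close> around the \<open>n\<close> zeros at \<open>s0\<close>. For \<open>s\<close> near \<open>s0\<close> each disc
  contains a zero, hence exactly one, and there are no others. These zeros depend continuously on
  \<open>s\<close> for the same reason, applied at other points and with smaller discs.
\<close>

lemma root_set_covering_space: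
  assumes F: "quasipolynomial S n F" "separable_on S F" and n: "0 < n"
  shows "covering_space (root_set S F) fst S"
  unfolding covering_space_def
proof (intro conjI ballI)
  let ?C = "root_set S F"
  have sq: "rsquarefree (F s)" "lead_coeff (F s) = 1" "degree (F s) = n" if "s \<in> S" for s
    using F that by (auto simp: quasipolynomial_def separable_on_def)
  show "continuous_on ?C fst" by (intro continuous_intros)
  show "fst ` ?C = S"
  proof -
    have "\<exists>z. poly (F s) z = 0" if "s \<in> S" for s
      using monic_squarefree_roots(2)[OF sq(1,2)[OF that]] sq(3)[OF that] n by (metis (mono_tags, lifting) Collect_empty_eq card.empty less_numeral_extra(3))
    then show ?thesis by (force simp: root_set_def)
  qed
  fix s0 assume s0: "s0 \<in> S"
  define R where "R = {z. poly (F s0) z = 0}"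
  note R0 = monic_squarefree_roots[OF sq(1,2)[OF s0], folded R_def]
  obtain \<epsilon> where \<epsilon>: "0 < \<epsilon>" and sep: "\<And>a b. a \<in> R \<Longrightarrow> b \<in> R \<Longrightarrow> a \<noteq> b \<Longrightarrow> 2 * \<epsilon> \<le> dist a b"
    using finite_separation[OF R0(3)] by blast
  have disj: "a = b" if "a \<in> R" "b \<in> R" "z \<in> ball a \<epsilon>" "z \<in> ball b \<epsilon>" for a b z
  proof (rule ccontr)
    assume "a \<noteq> b"
    have "dist a b \<le> dist a z + dist b z" by (rule dist_triangle2)
    then show False using sep[OF that(1,2) \<open>a \<noteq> b\<close>] that(3,4) by simp
  qed
  define T where "T = {s \<in> S. \<forall>z\<in>R. cmod (poly (F s) z) < \<epsilon> ^ n}"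
  have T: "T = S \<inter> (\<Inter>z\<in>R. {s \<in> S. cmod (poly (F s) z) \<in> {..<\<epsilon> ^ n}})" by (auto simp: T_def)
  have T_open: "openin (top_of_set S) T"
  proof -
    have op: "openin (top_of_set S) {s \<in> S. cmod (poly (F s) z) \<in> {..<\<epsilon> ^ n}}" for z
      by (rule continuous_openin_preimage_gen[where f = "\<lambda>s. cmod (poly (F s) z)", unfolded vimage_def Int_def mem_Collect_eq])
         (auto intro!: continuous_intros quasipolynomial_poly_continuous[OF F(1)])
    show ?thesis unfolding T
      by (cases "R = {}") (use R0(3) op in \<open>auto intro!: openin_Int openin_INT2\<close>)
  qed
  have "s0 \<in> T" using s0 \<epsilon> by (simp add: T_def R_def)
  have ex: "\<exists>w. poly (F s) w = 0 \<and> w \<in> ball z \<epsilon>" if "s \<in> T" "z \<in> R" for s z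
  proof -
    have "s \<in> S" "cmod (poly (F s) z) < \<epsilon> ^ degree (F s)" using that sq(3)[of s] by (auto simp: T_def)
    then obtain w where "poly (F s) w = 0" "cmod (w - z) < \<epsilon>"
      using root_near[OF sq(1,2) \<epsilon>] by blast
    then show ?thesis by (auto simp: dist_norm norm_minus_commute)
  qed
  define \<rho> where "\<rho> = (\<lambda>z s. SOME w. poly (F s) w = 0 \<and> w \<in> ball z \<epsilon>)"
  have \<rho>: "poly (F s) (\<rho> z s) = 0" "\<rho> z s \<in> ball z \<epsilon>" if "s \<in> T" "z \<in> R" for s z
    using someI_ex[OF ex[OF that]] by (auto simp: \<rho>_def)
  have all: "\<exists>z\<in>R. w = \<rho> z s" if s: "s \<in> T" and w: "poly (F s) w = 0" for s w
  proof -
    have "s \<in> S" using s by (auto simp: T_def)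
    have inj: "inj_on (\<lambda>z. \<rho> z s) R"
      using \<rho>[OF s] disj by (intro inj_onI) metis
    have "(\<lambda>z. \<rho> z s) ` R = {w. poly (F s) w = 0}"
    proof (rule card_subset_eq)
      show "finite {w. poly (F s) w = 0}" using monic_squarefree_roots(3)[OF sq(1,2)[OF \<open>s \<in> S\<close>]] .
      show "(\<lambda>z. \<rho> z s) ` R \<subseteq> {w. poly (F s) w = 0}" using \<rho>[OF s] by auto
      show "card ((\<lambda>z. \<rho> z s) ` R) = card {w. poly (F s) w = 0}"
        using card_image[OF inj] R0(2) monic_squarefree_roots(2)[OF sq(1,2)[OF \<open>s \<in> S\<close>]] sq(3) s0 \<open>s \<in> S\<close> by simp
    qed
    then show ?thesis using w by blast
  qed
  have uniq: "w = \<rho> z s" if "s \<in> T" "z \<in> R" "poly (F s) w = 0" "w \<in> ball z \<epsilon>" for s z w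
    using all[OF that(1,3)] \<rho>[OF that(1)] disj that by metis
  have cont: "continuous_on T (\<rho> z)" if z: "z \<in> R" for z
    unfolding continuous_on_iff
  proof (intro ballI allI impI)
    fix s1 and e :: real assume s1: "s1 \<in> T" and e: "0 < e"
    obtain e' where e': "0 < e'" "ball (\<rho> z s1) e' \<subseteq> ball z \<epsilon>"
      using \<rho>(2)[OF s1 z] openE[OF open_ball] by metis
    define e1 where "e1 = min e e'"
    have "0 < e1" using e e' by (simp add: e1_def)
    have s1S: "s1 \<in> S" using s1 by (auto simp: T_def)
    have "0 < e1 ^ n" using \<open>0 < e1\<close> by simp
    then obtain \<delta> where \<delta>: "0 < \<delta>" "\<And>s. s \<in> S \<Longrightarrow> dist s s1 < \<delta> \<Longrightarrow> dist (poly (F s) (\<rho> z s1)) (poly (F s1) (\<rho> z s1)) < e1 ^ n"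
      using quasipolynomial_poly_continuous[OF F(1), of "\<rho> z s1"] s1S unfolding continuous_on_iff by metis
    show "\<exists>\<delta>>0. \<forall>s\<in>T. dist s s1 < \<delta> \<longrightarrow> dist (\<rho> z s) (\<rho> z s1) < e"
    proof (intro exI[of _ \<delta>] conjI ballI impI)
      fix s assume s: "s \<in> T" "dist s s1 < \<delta>"
      have sS: "s \<in> S" using s by (auto simp: T_def)
      have "cmod (poly (F s) (\<rho> z s1)) < e1 ^ degree (F s)"
        using \<delta>(2)[OF sS s(2)] \<rho>(1)[OF s1 z] sq(3)[OF sS] by simp
      then obtain w where w: "poly (F s) w = 0" "cmod (w - \<rho> z s1) < e1"
        using root_near[OF sq(1,2)[OF sS] \<open>0 < e1\<close>] by blast
      then have "w \<in> ball (\<rho> z s1) e'" by (simp add: e1_def dist_norm norm_minus_commute)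
      then have "w = \<rho> z s" using e' uniq[OF s(1) z w(1)] by blast
      then show "dist (\<rho> z s) (\<rho> z s1) < e" using w(2) by (simp add: e1_def dist_norm)
    qed (rule \<delta>)
  qed
  define V where "V = (\<lambda>z. {(s, w). s \<in> T \<and> poly (F s) w = 0 \<and> w \<in> ball z \<epsilon>})"
  have TS: "T \<subseteq> S" by (auto simp: T_def)
  show "\<exists>T. s0 \<in> T \<and> openin (top_of_set S) T \<and>
      (\<exists>v. \<Union> v = ?C \<inter> fst -` T \<and> (\<forall>u\<in>v. openin (top_of_set ?C) u) \<and> pairwise disjnt v \<and>
        (\<forall>u\<in>v. \<exists>q. homeomorphism u T fst q))"
  proof (intro exI[of _ T] conjI exI[of _ "V ` R"] ballI)
    show "s0 \<in> T" by fact
    show "openin (top_of_set S) T" by fact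
    show "\<Union> (V ` R) = ?C \<inter> fst -` T"
    proof
      show "\<Union> (V ` R) \<subseteq> ?C \<inter> fst -` T" using TS by (auto simp: V_def root_set_def)
      show "?C \<inter> fst -` T \<subseteq> \<Union> (V ` R)"
      proof
        fix x assume x: "x \<in> ?C \<inter> fst -` T"
        obtain s w where "x = (s, w)" by (cases x)
        with x have s: "s \<in> T" "poly (F s) w = 0" by (auto simp: root_set_def)
        obtain z where "z \<in> R" "w = \<rho> z s" using all[OF s] by auto
        with s \<rho> have "x \<in> V z" by (auto simp: V_def \<open>x = (s, w)\<close>)
        with \<open>z \<in> R\<close> show "x \<in> \<Union> (V ` R)" by auto
      qed
    qed
    show "pairwise disjnt (V ` R)"
    proof (rule pairwiseI)
      fix u v assume "u \<in> V ` R" "v \<in> V ` R" "u \<noteq> v"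
      then obtain a b where "a \<in> R" "b \<in> R" "u = V a" "v = V b" "a \<noteq> b" by auto
      then show "disjnt u v" using disj unfolding disjnt_def V_def by blast
    qed
    show "openin (top_of_set ?C) u" if u: "u \<in> V ` R" for u
    proof -
      obtain z where z: "u = V z" using u by auto
      have 1: "openin (top_of_set ?C) (?C \<inter> fst -` T)"
        by (rule continuous_openin_preimage[OF _ _ T_open]) (auto simp: root_set_def intro!: continuous_intros)
      have 2: "openin (top_of_set ?C) (?C \<inter> snd -` ball z \<epsilon>)"
        by (intro continuous_openin_preimage_gen continuous_intros) auto
      have "u = (?C \<inter> fst -` T) \<inter> (?C \<inter> snd -` ball z \<epsilon>)"
        using TS by (auto simp: z V_def root_set_def)
      then show ?thesis using openin_Int[OF 1 2] by simp
    qed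
    show "\<exists>q. homeomorphism u T fst q" if u: "u \<in> V ` R" for u
    proof -
      obtain z where z: "z \<in> R" "u = V z" using u by auto
      have "homeomorphism u T fst (\<lambda>s. (s, \<rho> z s))"
      proof (rule homeomorphismI)
        show "continuous_on T (\<lambda>s. (s, \<rho> z s))" by (intro continuous_intros cont z)
        show "continuous_on u fst" by (intro continuous_intros)
        show "fst ` u \<subseteq> T" by (auto simp: z V_def)
        show "(\<lambda>s. (s, \<rho> z s)) ` T \<subseteq> u" using \<rho> z by (auto simp: V_def)
        show "(fst x, \<rho> z (fst x)) = x" if "x \<in> u" for x
          using that uniq z by (auto simp: V_def)
      qed auto
      then show ?thesis by blast
    qed
  qed
qed

lemma root_lift:
  fixes S :: "complex set" and F :: "complex \<Rightarrow> complex poly"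
  assumes F: "quasipolynomial S n F" "separable_on S F" and n: "0 < n"
    and S: "convex S" "s0 \<in> S" and z: "poly (F s0) z = 0"
  obtains P where "continuous_on S P" "\<And>s. s \<in> S \<Longrightarrow> poly (F s) (P s) = 0" "P s0 = z"
proof -
  obtain g where g: "continuous_on S g" "g \<in> S \<rightarrow> root_set S F" "g s0 = (s0, z)" "\<And>s. s \<in> S \<Longrightarrow> fst (g s) = s"
  proof (rule covering_space_lift_strong[OF root_set_covering_space[OF F n], of "(s0, z)" s0 S "\<lambda>s. s"])
    show "(s0, z) \<in> root_set S F" using S z by (simp add: root_set_def)
    show "simply_connected S" "locally path_connected S"
      using S convex_imp_simply_connected convex_imp_locally_path_connected by auto
  qed (use S in \<open>auto intro!: continuous_intros\<close>)
  show ?thesis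
  proof (rule that[of "\<lambda>s. snd (g s)"])
    show "continuous_on S (\<lambda>s. snd (g s))" using g by (intro continuous_intros)
    show "poly (F s) (snd (g s)) = 0" if "s \<in> S" for s
      using g(2,4) that by (force simp: root_set_def)
  qed (use g in auto)
qed

lemma root_lift_unique:
  fixes S :: "complex set" and F :: "complex \<Rightarrow> complex poly"
  assumes F: "quasipolynomial S n F" "separable_on S F" and n: "0 < n" and S: "connected S"
    and P: "continuous_on S P" "\<And>s. s \<in> S \<Longrightarrow> poly (F s) (P s) = 0"
    and Q: "continuous_on S Q" "\<And>s. s \<in> S \<Longrightarrow> poly (F s) (Q s) = 0"
    and eq: "s0 \<in> S" "P s0 = Q s0" and s: "s \<in> S"
  shows "P s = Q s"
proof -
  have "(s, P s) = (s, Q s)"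
    by (rule covering_space_lift_unique[OF root_set_covering_space[OF F n], of "\<lambda>s. (s, P s)" s0 "\<lambda>s. (s, Q s)" S "\<lambda>s. s" s])
       (use assms in \<open>auto intro!: continuous_intros simp: root_set_def\<close>)
  then show ?thesis by simp
qed

text \<open>
  Expand \<open>0 = F s (P s)\<close> around \<open>s0\<close> with \<open>F s0 = (X - a) q\<close> and \<open>a = P s0\<close>. The difference quotient
  of \<open>P\<close> becomes, up to sign, that of the polynomials \<open>F s\<close> at \<open>P s\<close>, divided by \<open>q (P s)\<close>, and \<open>q
  a\<close> does not vanish as \<open>a\<close> is a simple zero.
\<close>

lemma root_holomorphic:
  assumes F: "quasipolynomial S n F" "separable_on S F"
    and hol: "\<And>j. j < n \<Longrightarrow> (\<lambda>s. coeff (F s) j) holomorphic_on S" and S: "open S"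
    and P: "continuous_on S P" "\<And>s. s \<in> S \<Longrightarrow> poly (F s) (P s) = 0"
  shows "P holomorphic_on S"
  unfolding holomorphic_on_open[OF S]
proof (intro ballI)
  fix s0 assume s0: "s0 \<in> S"
  define a where "a = P s0"
  define p where "p = F s0"
  define q where "q = synthetic_div p a"
  have pq: "poly p z = (z - a) * poly q z" for z
    using arg_cong[OF synthetic_div_correct'[of a p], of "\<lambda>r. poly r z"] P(2)[OF s0]
    by (simp add: q_def p_def a_def algebra_simps)
  have p_fact: "p = [:-a, 1:] * q"
    using synthetic_div_correct'[of a p] P(2)[OF s0] by (simp add: q_def p_def a_def)
  have "poly (pderiv p) a = poly q a"
    by (subst p_fact) (simp add: pderiv_mult pderiv_pCons del: mult_pCons_left)
  moreover have "poly p a = 0" using P(2)[OF s0] by (simp add: p_def a_def)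
  moreover have "rsquarefree p" using F(2) s0 by (simp add: separable_on_def p_def)
  ultimately have qa: "poly q a \<noteq> 0" unfolding rsquarefree_roots by metis
  have Pc: "(P \<longlongrightarrow> a) (at s0)"
    using P(1) s0 S unfolding a_def by (simp add: continuous_on_eq_continuous_at isCont_def)
  have qc: "((\<lambda>s. poly q (P s)) \<longlongrightarrow> poly q a) (at s0)"
    by (rule isCont_tendsto_compose[OF _ Pc]) simp
  define c where "c = (\<lambda>j s. coeff (F s) j)"
  have dc: "\<exists>D. ((\<lambda>s. (c j s - c j s0) / (s - s0)) \<longlongrightarrow> D) (at s0)" if "j < n" for j
  proof -
    have "((\<lambda>s. c j s) has_field_derivative deriv (c j) s0) (at s0)"
      using holomorphic_derivI[OF hol[OF that] S s0] by (simp add: c_def)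
    then show ?thesis by (auto simp: has_field_derivative_iff)
  qed
  then obtain D where D: "\<And>j. j < n \<Longrightarrow> ((\<lambda>s. (c j s - c j s0) / (s - s0)) \<longlongrightarrow> D j) (at s0)" by metis
  let ?E = "\<lambda>s. - (\<Sum>j<n. (c j s - c j s0) / (s - s0) * P s ^ j) / poly q (P s)"
  have lim: "(?E \<longlongrightarrow> - (\<Sum>j<n. D j * a ^ j) / poly q a) (at s0)"
    using qa by (intro tendsto_intros D Pc qc) auto
  have ev: "\<forall>\<^sub>F s in at s0. ?E s = (P s - P s0) / (s - s0)"
  proof -
    have 1: "\<forall>\<^sub>F s in at s0. poly q (P s) \<noteq> 0" using qc qa by (rule tendsto_imp_eventually_ne)
    have 2: "\<forall>\<^sub>F s in at s0. s \<in> S" using S s0 by (rule eventually_at_in_open')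
    show ?thesis using 1 2
    proof eventually_elim
      case (elim s)
      have top: "c n s = 1" "c n s0 = 1" using F(1) elim s0 by (auto simp: c_def quasipolynomial_def)
      have "0 = (\<Sum>j\<le>n. c j s * P s ^ j)"
        using P(2)[OF elim(2)] quasipolynomial_poly[OF F(1) elim(2)] by (simp add: c_def)
      moreover have "(P s - a) * poly q (P s) = (\<Sum>j\<le>n. c j s0 * P s ^ j)"
        unfolding pq[symmetric] p_def quasipolynomial_poly[OF F(1) s0] c_def ..
      ultimately have "(P s - a) * poly q (P s) = - (\<Sum>j\<le>n. (c j s - c j s0) * P s ^ j)"
        by (simp add: left_diff_distrib sum_subtractf)
      also have "(\<Sum>j\<le>n. (c j s - c j s0) * P s ^ j) = (\<Sum>j<n. (c j s - c j s0) * P s ^ j)"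
        by (simp add: top flip: lessThan_Suc_atMost)
      finally have "P s - a = - (\<Sum>j<n. (c j s - c j s0) * P s ^ j) / poly q (P s)"
        using elim(1) by (metis nonzero_mult_div_cancel_right)
      then show ?case by (simp add: a_def sum_divide_distrib mult.commute)
    qed
  qed
  have "((\<lambda>s. (P s - P s0) / (s - s0)) \<longlongrightarrow> - (\<Sum>j<n. D j * a ^ j) / poly q a) (at s0)"
    using lim by (rule Lim_transform_eventually) (rule ev)
  then show "\<exists>f'. (P has_field_derivative f') (at s0)"
    unfolding has_field_derivative_iff by blast
qed

text \<open>
  Comparing coefficients from the top down expresses those of \<open>h\<close> through those of \<open>f\<close> and \<open>g\<close>, because
  \<open>g\<close> is monic.
\<close>

lemma quasipolynomial_quotient:
  assumes f: "quasipolynomial X (m + l) f" and g: "quasipolynomial X m g"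
    and h: "\<And>x. x \<in> X \<Longrightarrow> degree (h x) = l \<and> lead_coeff (h x) = 1"
    and fgh: "\<And>x. x \<in> X \<Longrightarrow> f x = g x * h x"
  shows "quasipolynomial X l h"
proof -
  have "continuous_on X (\<lambda>x. coeff (h x) j)" for j
  proof (induction "l - j" arbitrary: j rule: less_induct)
    case less
    consider "l < j" | "j = l" | "j < l" by linarith
    then show ?case
    proof cases
      case 1
      then have "coeff (h x) j = 0" if "x \<in> X" for x using h[OF that] by (simp add: coeff_eq_0)
      then show ?thesis using continuous_on_cong[of X X "\<lambda>x. coeff (h x) j" "\<lambda>_. 0"] by simp
    next
      case 2
      then have "coeff (h x) j = 1" if "x \<in> X" for x using h[OF that] 2 by auto
      then show ?thesis using continuous_on_cong[of X X "\<lambda>x. coeff (h x) j" "\<lambda>_. 1"] by simp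
    next
      case 3
      have eq: "coeff (h x) j = coeff (f x) (m + j) - (\<Sum>i<m. coeff (g x) i * coeff (h x) (m + j - i))"
        if x: "x \<in> X" for x
      proof -
        have dg: "degree (g x) = m" "coeff (g x) m = 1" using g x by (auto simp: quasipolynomial_def)
        have "coeff (f x) (m + j) = (\<Sum>i\<le>m + j. coeff (g x) i * coeff (h x) (m + j - i))"
          unfolding fgh[OF x] coeff_mult ..
        also have "\<dots> = (\<Sum>i\<le>m. coeff (g x) i * coeff (h x) (m + j - i))"
          by (rule sum.mono_neutral_right) (auto simp: dg coeff_eq_0)
        also have "\<dots> = (\<Sum>i<m. coeff (g x) i * coeff (h x) (m + j - i)) + coeff (h x) j"
          by (simp add: dg flip: lessThan_Suc_atMost)
        finally show ?thesis by simp
      qed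
      have "continuous_on X (\<lambda>x. coeff (f x) (m + j) - (\<Sum>i<m. coeff (g x) i * coeff (h x) (m + j - i)))"
        using 3 by (intro continuous_intros quasipolynomial_coeff_continuous[OF f] quasipolynomial_coeff_continuous[OF g] less) auto
      then show ?thesis using eq by (subst continuous_on_cong[OF refl]) auto
    qed
  qed
  then show ?thesis using h by (auto simp: quasipolynomial_def)
qed

lemma coeff_root_product_continuous:
  assumes "finite A" "\<And>a. a \<in> A \<Longrightarrow> continuous_on S (\<lambda>s. p a s :: complex)"
  shows "continuous_on S (\<lambda>s. coeff (\<Prod>a\<in>A. [:- p a s, 1:]) j)"
  using assms
proof (induction A arbitrary: j rule: finite_induct)
  case (insert a A)
  have IH: "continuous_on S (\<lambda>s. coeff (\<Prod>a\<in>A. [:- p a s, 1:]) j)" for j using insert by simp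
  have "continuous_on S (\<lambda>s. - p a s * coeff (\<Prod>a\<in>A. [:- p a s, 1:]) j
       + (case j of 0 \<Rightarrow> 0 | Suc i \<Rightarrow> coeff (\<Prod>a\<in>A. [:- p a s, 1:]) i))"
    using insert.prems by (cases j) (auto intro!: continuous_intros IH)
  then show ?case using insert.hyps by (simp add: coeff_pCons)
qed simp

text \<open>
  Near \<open>exp s0\<close> the map \<open>exp\<close> has the continuous section \<open>x \<mapsto> s0 + Ln (x / exp s0)\<close>.
\<close>

lemma continuous_on_exp_descend:
  fixes g :: "complex \<Rightarrow> complex"
  assumes S: "open S" and c: "continuous_on S (\<lambda>s. g (exp s))"
  shows "continuous_on (exp ` S) g"
proof -
  have "isCont g (exp s0)" if s0: "s0 \<in> S" for s0
  proof -
    let ?h = "\<lambda>x. s0 + Ln (x / exp s0)"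
    have h: "isCont ?h (exp s0)" by (intro continuous_intros) auto
    have "isCont (\<lambda>s. g (exp s)) (?h (exp s0))" using c S s0 by (simp add: continuous_on_eq_continuous_at)
    with h have "isCont (\<lambda>x. g (exp (?h x))) (exp s0)" by (rule isCont_o2)
    moreover have "\<forall>\<^sub>F x in nhds (exp s0). g (exp (?h x)) = g x"
    proof -
      have "\<forall>\<^sub>F x in nhds (exp s0). x \<noteq> 0" using exp_not_eq_zero by (intro t1_space_nhds)
      then show ?thesis by eventually_elim (simp add: exp_add)
    qed
    ultimately show ?thesis by (subst (asm) isCont_cong)
  qed
  then show ?thesis by (auto intro!: continuous_at_imp_continuous_on)
qed

section \<open>The period of a zero, and reducibility\<close>

text \<open>
  By uniqueness of lifts, two translates of \<open>P\<close> agree everywhere or nowhere. The integers \<open>k\<close> for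
  which \<open>turn k\<close> is a period of \<open>P\<close> therefore form a subgroup of the integers, and the pigeonhole
  principle provides a positive element that is at most \<open>n\<close>.
\<close>

lemma root_period:
  fixes S :: "complex set" and F :: "complex \<Rightarrow> complex poly"
  assumes F: "quasipolynomial S n F" "separable_on S F" and n: "0 < n"
    and S: "connected S" "s0 \<in> S" and shift: "\<And>s k. s \<in> S \<Longrightarrow> s + turn k \<in> S"
    and per: "\<And>s k. F (s + turn k) = F s"
    and P: "continuous_on S P" "\<And>s. s \<in> S \<Longrightarrow> poly (F s) (P s) = 0"
  obtains m where "0 < m" "m \<le> n"
    "\<And>s i j. s \<in> S \<Longrightarrow> P (s + turn i) = P (s + turn j) \<longleftrightarrow> [i = j] (mod int m)"
proof -
  define G where "G = (\<lambda>k. \<forall>s\<in>S. P (s + turn k) = P s)"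
  have Pk: "continuous_on S (\<lambda>s. P (s + turn k))" for k
    by (rule continuous_on_compose2[OF P(1)]) (auto intro!: continuous_intros shift)
  have Pr: "poly (F s) (P (s + turn k)) = 0" if "s \<in> S" for s k
    using P(2)[OF shift[OF that, of k]] per by simp
  have G_iff: "P (s + turn i) = P (s + turn j) \<longleftrightarrow> G (i - j)" if s: "s \<in> S" for s i j
  proof
    assume eq: "P (s + turn i) = P (s + turn j)"
    have all: "P (t + turn i) = P (t + turn j)" if "t \<in> S" for t
      by (rule root_lift_unique[OF F n S(1), of "\<lambda>t. P (t + turn i)" "\<lambda>t. P (t + turn j)" s])
         (use Pk Pr eq s that in auto)
    show "G (i - j)" unfolding G_def
    proof
      fix t assume "t \<in> S"
      then show "P (t + turn (i - j)) = P t"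
        using all[OF shift[of t "-j"]] by (simp add: turn_diff turn_minus algebra_simps)
    qed
  next
    assume "G (i - j)"
    then have "P (s + turn j + turn (i - j)) = P (s + turn j)" using shift[OF s] by (auto simp: G_def)
    then show "P (s + turn i) = P (s + turn j)" by (simp add: turn_diff algebra_simps)
  qed
  have G_diff: "G (a - b)" if "G a" "G b" for a b
    using that G_iff[OF S(2), of a b] S(2) by (simp add: G_def)
  have G0: "G 0" by (simp add: G_def)
  have G_mult: "G (k * a)" if "G a" for a k
  proof (induction k rule: int_induct[where k = 0])
    case base
    then show ?case using G0 by simp
  next
    case (step1 k)
    then show ?case using G_diff[OF step1(2) G_diff[OF G0 that]] by (simp add: algebra_simps)
  next
    case (step2 k)
    then show ?case using G_diff[OF step2(2) that] by (simp add: algebra_simps)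
  qed
  let ?R = "{z. poly (F s0) z = 0}"
  have sq: "rsquarefree (F s0)" "lead_coeff (F s0) = 1" "degree (F s0) = n"
    using F S by (auto simp: quasipolynomial_def separable_on_def)
  note R = monic_squarefree_roots(2,3)[OF sq(1,2)]
  have "card ((\<lambda>j. P (s0 + turn (int j))) ` {..n}) \<le> card ?R"
    using Pr[OF S(2)] R(2) by (intro card_mono) auto
  then have "\<not> inj_on (\<lambda>j. P (s0 + turn (int j))) {..n}"
    using R(1) sq(3) by (intro pigeonhole) simp
  then obtain i j :: nat where ij: "i \<le> n" "j \<le> n" "i < j" "P (s0 + turn (int j)) = P (s0 + turn (int i))"
    unfolding inj_on_def by (metis atMost_iff linorder_neqE_nat)
  then have "G (int (j - i))" using G_iff[OF S(2), of j i] by (simp add: of_nat_diff)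
  then have ji: "0 < j - i \<and> G (int (j - i))" using ij by simp
  then have ex: "\<exists>m. 0 < m \<and> G (int m)" by blast
  define m where "m = (LEAST m. 0 < m \<and> G (int m))"
  have m: "0 < m" "G (int m)" using LeastI_ex[OF ex] by (auto simp: m_def)
  have "m \<le> j - i" unfolding m_def by (rule Least_le) (rule ji)
  then have "m \<le> n" using ij by simp
  have "G k \<longleftrightarrow> int m dvd k" for k
  proof
    assume k: "G k"
    have "G (k mod int m)" using G_diff[OF k G_mult[OF m(2), of "k div int m"]] by (simp add: minus_div_mult_eq_mod)
    then have "G (int (nat (k mod int m)))" using m by simp
    then have "\<not> 0 < nat (k mod int m)"
      using not_less_Least[of "nat (k mod int m)" "\<lambda>m. 0 < m \<and> G (int m)", folded m_def] m
      by (auto simp: nat_less_iff)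
    then have "k mod int m \<le> 0" by simp
    moreover have "0 \<le> k mod int m" using m by simp
    ultimately show "int m dvd k" by (intro mod_0_imp_dvd) linarith
  next
    assume "int m dvd k"
    then show "G k" using G_mult[OF m(2)] by (metis dvdE mult.commute)
  qed
  then show ?thesis using m \<open>m \<le> n\<close> G_iff by (intro that[of m]) (auto simp: cong_iff_dvd_diff)
qed

text \<open>
  The \<open>m\<close> translates of \<open>P\<close> are permuted by a turn. The monic polynomial with these zeros thus
  descends to a proper factor of \<open>f\<close> on \<open>X\<close>.
\<close>

lemma reducible_if_short_period:
  assumes X: "open S" "\<And>s. s \<in> S \<longleftrightarrow> exp s \<in> X" "0 \<notin> X"
    and f: "quasipolynomial X n f" "separable_on X f"
    and P: "continuous_on S P" "\<And>s. s \<in> S \<Longrightarrow> poly (f (exp s)) (P s) = 0"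
    and m: "0 < m" "m < n"
    and iff: "\<And>s i j. s \<in> S \<Longrightarrow> P (s + turn i) = P (s + turn j) \<longleftrightarrow> [i = j] (mod int m)"
  shows "reducible_on X f"
proof -
  define Z where "Z = (\<lambda>s. range (\<lambda>k. P (s + turn k)))"
  have Z_sub: "Z (s + turn k) \<subseteq> Z s" for s k
    by (auto simp: Z_def add.assoc simp flip: turn_add)
  have Z_turn: "Z (s + turn k) = Z s" for s k
    using Z_sub[of s k] Z_sub[of "s + turn k" "- k"] by (simp add: turn_minus)
  have Z: "Z s = (\<lambda>j. P (s + turn (int j))) ` {..<m}" "inj_on (\<lambda>j. P (s + turn (int j))) {..<m}"
    if s: "s \<in> S" for s
  proof -
    have "P (s + turn k) \<in> (\<lambda>j. P (s + turn (int j))) ` {..<m}" for k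
    proof (rule image_eqI)
      show "P (s + turn k) = P (s + turn (int (nat (k mod int m))))"
        using iff[OF s] m by (simp add: cong_def)
      show "nat (k mod int m) \<in> {..<m}" using m by (simp add: nat_less_iff)
    qed
    then show "Z s = (\<lambda>j. P (s + turn (int j))) ` {..<m}" by (auto simp: Z_def)
    show "inj_on (\<lambda>j. P (s + turn (int j))) {..<m}"
      using iff[OF s] by (intro inj_onI) (auto simp: cong_def)
  qed
  have shift: "s + turn k \<in> S" if "s \<in> S" for s k using that X(2) by simp
  define g where "g = (\<lambda>x. \<Prod>z\<in>Z (Ln x). [:- z, 1:])"
  define h where "h = (\<lambda>x. \<Prod>z\<in>{z. poly (f x) z = 0} - Z (Ln x). [:- z, 1:])"
  have ZLn: "Z (Ln (exp s)) = Z s" for s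
  proof -
    obtain k where "Ln (exp s) = s + turn k" using exp_eq_turn[of "Ln (exp s)" s] by auto
    then show ?thesis by (simp add: Z_turn)
  qed
  have g_exp: "g (exp s) = (\<Prod>j<m. [:- P (s + turn (int j)), 1:])" if s: "s \<in> S" for s
    unfolding g_def ZLn Z(1)[OF s] by (simp add: prod.reindex[OF Z(2)[OF s]])
  have X_exp: "X = exp ` S"
  proof
    show "X \<subseteq> exp ` S"
    proof
      fix x assume x: "x \<in> X"
      then have "exp (Ln x) = x" using X(3) by (metis exp_Ln)
      then show "x \<in> exp ` S" using X(2) x by (metis imageI)
    qed
  qed (use X in auto)
  have g: "quasipolynomial X m g"
    unfolding quasipolynomial_def
  proof (intro conjI ballI allI impI)
    show "degree (g x) = m" "lead_coeff (g x) = 1" if "x \<in> X" for x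
      using that g_exp degree_root_product[of "\<lambda>j. P (_ + turn (int j))" "{..<m}"]
        lead_coeff_root_product[of "\<lambda>j. P (_ + turn (int j))" "{..<m}"]
      unfolding X_exp by auto
    fix j
    have "continuous_on S (\<lambda>s. coeff (\<Prod>j<m. [:- P (s + turn (int j)), 1:]) j)"
      by (intro coeff_root_product_continuous continuous_on_compose2[OF P(1)])
         (auto intro!: continuous_intros shift)
    then have "continuous_on S (\<lambda>s. coeff (g (exp s)) j)"
      using g_exp by (subst continuous_on_cong[OF refl]) auto
    then show "continuous_on X (\<lambda>x. coeff (g x) j)"
      unfolding X_exp by (rule continuous_on_exp_descend[OF X(1)])
  qed
  have fact: "f x = g x * h x \<and> degree (h x) = n - m \<and> lead_coeff (h x) = 1" if x: "x \<in> X" for x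
  proof -
    let ?R = "{z. poly (f x) z = 0}"
    have sq: "rsquarefree (f x)" "lead_coeff (f x) = 1" "degree (f x) = n"
      using f that by (auto simp: quasipolynomial_def separable_on_def)
    note R = monic_squarefree_roots[OF sq(1,2)]
    obtain s where s: "s \<in> S" "x = exp s" using x unfolding X_exp by auto
    have sub: "Z (Ln x) \<subseteq> ?R"
      using P(2)[OF shift[OF s(1)]] unfolding s(2) ZLn by (auto simp: Z_def)
    have card: "card (Z (Ln x)) = m"
      unfolding s(2) ZLn Z(1)[OF s(1)] using card_image[OF Z(2)[OF s(1)]] by simp
    have "f x = g x * h x"
      using prod.subset_diff[OF sub R(3), of "\<lambda>z. [:- z, 1:]"] R(1) by (simp add: g_def h_def mult.commute)
    moreover have "degree (h x) = card (?R - Z (Ln x))"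
      unfolding h_def by (rule degree_root_product)
    moreover have "card (?R - Z (Ln x)) = n - m"
      using card_Diff_subset[OF finite_subset[OF sub R(3)] sub] R(2) sq(3) card by simp
    moreover have "lead_coeff (h x) = 1" unfolding h_def by (rule lead_coeff_root_product)
    ultimately show ?thesis by simp
  qed
  have "quasipolynomial X (n - m) h"
  proof (rule quasipolynomial_quotient[where f = f and g = g and m = m])
    show "quasipolynomial X (m + (n - m)) f" using f(1) m by simp
    show "quasipolynomial X m g" by (rule g)
    show "degree (h x) = n - m \<and> lead_coeff (h x) = 1" "f x = g x * h x" if "x \<in> X" for x
      using fact[OF that] by blast+
  qed
  then show ?thesis
    using g fact m unfolding reducible_on_def irreducible_on_def not_not
    by (intro exI[of _ m] exI[of _ "n - m"] exI[of _ g] exI[of _ h]) auto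
qed

section \<open>The index of the discriminant\<close>

context cyclic_roots
begin

text \<open>
  The function \<open>\<Lambda>\<close> is a logarithm of the discriminant along \<open>S\<close>. One turn adds \<open>2\<pi>i\<close> times the
  index \<open>\<delta>\<close>, so \<open>n\<close> turns add \<open>2\<pi>i n \<delta>\<close>. On the other hand each of the \<open>n (n - 1) / 2\<close> pairs
  of zeros contributes twice the common winding number \<open>w\<close>. Hence \<open>\<delta> = (n - 1) w\<close>.
\<close>

lemma discriminant_index_not_divisible:
  assumes zero: "0 \<in> S" and f: "\<And>s. s \<in> S \<Longrightarrow> f (exp s) = (\<Prod>j<n. [:- P (s + turn (int j)), 1:])"
  shows "\<not> int n dvd discriminant_index f"
proof -
  obtain w where w: "\<And>k. \<not> int n dvd k \<Longrightarrow> winding k = w" "\<not> int n dvd w"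
    using common_winding_number by metis
  define \<Lambda> where "\<Lambda> = (\<lambda>s. \<Sum>j<n. \<Sum>i<j. 2 * difference_log (int j - int i) (s + turn (int i)))"
  have nd: "\<not> int n dvd int j - int i" if "i < j" "j < n" for i j
    using that by (intro zdvd_not_zless) auto
  have \<Lambda>c: "continuous_on S \<Lambda>"
    unfolding \<Lambda>_def using nd by (intro continuous_intros difference_log_turn_cont) auto
  have disc: "discriminant (f (exp s)) = exp (\<Lambda> s)" if s: "s \<in> S" for s
  proof -
    let ?zs = "map (\<lambda>j. P (s + turn (int j))) [0..<n]"
    have "f (exp s) = (\<Prod>z\<leftarrow>?zs. [:- z, 1:])"
      unfolding f[OF s]
      using prod.distinct_set_conv_list[of "[0..<n]" "\<lambda>j. [:- P (s + turn (int j)), 1:]"]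
      by (simp add: o_def atLeast0LessThan)
    then have "discriminant (f (exp s)) = list_discriminant ?zs" by (rule discriminant_eq)
    also have "\<dots> = (\<Prod>j<n. \<Prod>i<j. (P (s + turn (int i)) - P (s + turn (int j)))\<^sup>2)"
      unfolding list_discriminant_def by (auto intro!: prod.cong)
    also have "\<dots> = (\<Prod>j<n. \<Prod>i<j. exp (2 * difference_log (int j - int i) (s + turn (int i))))"
    proof (intro prod.cong refl)
      fix j i assume ij: "j \<in> {..<n}" "i \<in> {..<j}"
      have "exp (difference_log (int j - int i) (s + turn (int i))) = P (s + turn (int i)) - P (s + turn (int j))"
        using exp_difference_log_turn[OF nd s, of i j "int i"] ij by simp
      then show "(P (s + turn (int i)) - P (s + turn (int j)))\<^sup>2 = exp (2 * difference_log (int j - int i) (s + turn (int i)))"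
        by (simp add: exp_double)
    qed
    also have "\<dots> = exp (\<Lambda> s)" by (simp add: \<Lambda>_def exp_sum)
    finally show ?thesis .
  qed
  have "continuous_on S (\<lambda>s. \<Lambda> (s + turn 1))"
    by (rule continuous_on_compose2[OF \<Lambda>c]) (auto intro!: continuous_intros)
  moreover have "exp (\<Lambda> (s + turn 1)) = exp (\<Lambda> s)" if "s \<in> S" for s
    using disc[OF that] disc[of "s + turn 1"] that by simp
  ultimately obtain \<delta> where \<delta>: "\<And>s. s \<in> S \<Longrightarrow> \<Lambda> (s + turn 1) = \<Lambda> s + turn \<delta>"
    using logs_differ_by_turn[OF S_connected, of "\<lambda>s. \<Lambda> (s + turn 1)" \<Lambda>] \<Lambda>c by blast
  have "\<Lambda> (turn (int m)) = \<Lambda> 0 + turn (int m * \<delta>)" for m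
  proof (induction m)
    case (Suc m)
    have "\<Lambda> (turn (int (Suc m))) = \<Lambda> ((0 + turn (int m)) + turn 1)" by (simp add: turn_add add.commute)
    also have "\<dots> = \<Lambda> (turn (int m)) + turn \<delta>" using \<delta>[of "0 + turn (int m)"] zero S_turn(1)[of 0 "int m"] by simp
    also have "\<dots> = \<Lambda> 0 + turn (int (Suc m) * \<delta>)" unfolding Suc by (simp add: turn_def algebra_simps)
    finally show ?case .
  qed simp
  then have 1: "\<Lambda> (0 + turn (int n)) = \<Lambda> 0 + turn (int n * \<delta>)" by simp
  have "\<Lambda> (0 + turn (int n)) = (\<Sum>j<n. \<Sum>i<j. 2 * difference_log (int j - int i) (0 + turn (int i)) + 2 * turn w)"
    unfolding \<Lambda>_def
  proof (intro sum.cong refl)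
    fix j i assume ij: "j \<in> {..<n}" "i \<in> {..<j}"
    then have k: "\<not> int n dvd int j - int i" using nd by simp
    have "difference_log (int j - int i) ((0 + turn (int i)) + turn (int n)) = difference_log (int j - int i) (0 + turn (int i)) + turn w"
      using winding[OF k, of "0 + turn (int i)"] w(1)[OF k] zero S_turn(1)[of 0 "int i"] by simp
    then show "2 * difference_log (int j - int i) (0 + turn (int n) + turn (int i)) = 2 * difference_log (int j - int i) (0 + turn (int i)) + 2 * turn w"
      by (simp add: add.commute)
  qed
  also have "\<dots> = \<Lambda> 0 + (\<Sum>j<n. of_nat j * (2 * turn w))"
    by (simp add: \<Lambda>_def sum.distrib)
  also have "(\<Sum>j<n. of_nat j * (2 * turn w)) = turn (int n * (int n - 1) * w)"
  proof -
    have "(\<Sum>j<k. of_nat j * (2 * turn w)) = turn (int k * (int k - 1) * w)" for k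
      by (induction k) (simp_all add: turn_def algebra_simps)
    then show ?thesis .
  qed
  finally have "\<Lambda> 0 + turn (int n * \<delta>) = \<Lambda> 0 + turn (int n * (int n - 1) * w)"
    unfolding 1 .
  then have "turn (int n * \<delta>) = turn (int n * (int n - 1) * w)" by (rule add_left_imp_eq)
  then have "int n * \<delta> = int n * ((int n - 1) * w)" by (simp only: turn_eq_iff mult.assoc)
  then have \<delta>w: "\<delta> = (int n - 1) * w" using npos by (simp only: mult_cancel_left) simp
  have "discriminant_index f = \<delta>"
    unfolding discriminant_index_def
  proof (rule circle_degree_eqI[where \<phi> = "\<lambda>t. Im (\<Lambda> (of_real (2 * pi * t) * \<i>)) / (2 * pi)"])
    have inS: "of_real (2 * pi * t) * \<i> \<in> S" for t :: real using S_shift[OF zero] by simp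
    show "continuous_on {0..1} (\<lambda>t. Im (\<Lambda> (of_real (2 * pi * t) * \<i>)) / (2 * pi))"
      by (intro continuous_intros continuous_on_compose2[OF \<Lambda>c]) (use inS in auto)
    fix t :: real
    have "cis (2 * pi * t) = exp (of_real (2 * pi * t) * \<i>)" by (simp add: cis_conv_exp mult.commute)
    then have "discriminant (f (cis (2 * pi * t))) = exp (\<Lambda> (of_real (2 * pi * t) * \<i>))"
      using disc[OF inS] by simp
    then show "discriminant (f (cis (2 * pi * t))) / complex_of_real (cmod (discriminant (f (cis (2 * pi * t))))) =
         cis (2 * pi * (Im (\<Lambda> (complex_of_real (2 * pi * t) * \<i>)) / (2 * pi)))"
      by (simp add: exp_eq_polar norm_mult)
  next
    have "\<Lambda> (of_real (2 * pi * 1) * \<i>) = \<Lambda> 0 + turn \<delta>" using \<delta>[OF zero] by (simp add: turn_def)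
    then show "Im (\<Lambda> (of_real (2 * pi * 1) * \<i>)) / (2 * pi) - Im (\<Lambda> (of_real (2 * pi * 0) * \<i>)) / (2 * pi) = of_int \<delta>"
      by (simp add: turn_def field_simps)
  qed
  moreover have "\<not> int n dvd \<delta>"
  proof
    assume "int n dvd \<delta>"
    then have "int n dvd int n * w - \<delta>" by (intro dvd_diff) auto
    then show False using w(2) by (simp add: \<delta>w algebra_simps)
  qed
  ultimately show ?thesis by simp
qed

end

text \<open>
  The logarithmic width of the annulus is \<open>2\<pi>\<close> times its conformal module. If it is infinite, there are
  strips of every width.
\<close>

lemma annulus_strip:
  assumes "0 \<le> r" "r < 1" "1 < R" and w: "0 < w"
    and mod: "conformal_module r R > ereal (w / pi)"
  obtains x0 where "\<And>x. \<bar>x - x0\<bar> < w \<Longrightarrow> r < exp x \<and> ereal (exp x) < R"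
proof (cases R)
  case (real \<rho>)
  then have \<rho>: "1 < \<rho>" using assms by simp
  have up: "ereal (exp x) < R" if "x < ln \<rho>" for x
  proof -
    have "exp x < exp (ln \<rho>)" using that by simp
    then show ?thesis using real \<rho> by simp
  qed
  show ?thesis
  proof (cases "r = 0")
    case True
    show ?thesis by (rule that[of "ln \<rho> - w"]) (use True up in auto)
  next
    case False
    then have r: "0 < r" using assms by simp
    have "w / pi < 1 / (2 * pi) * ln (\<rho> / r)"
      using mod False real by (simp add: conformal_module_def)
    then have "2 * w < ln \<rho> - ln r" using r \<rho> by (simp add: ln_div field_simps)
    show ?thesis
    proof (rule that[of "(ln r + ln \<rho>) / 2"])
      fix x assume x: "\<bar>x - (ln r + ln \<rho>) / 2\<bar> < w"
      then have "ln r < x" "x < ln \<rho>" using \<open>2 * w < ln \<rho> - ln r\<close> by (auto simp: abs_less_iff field_simps)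
      then have "exp (ln r) < exp x" by simp
      then show "r < exp x \<and> ereal (exp x) < R" using r up[OF \<open>x < ln \<rho>\<close>] by simp
    qed
  qed
next
  case PInf
  show ?thesis
  proof (cases "r = 0")
    case True
    show ?thesis by (rule that[of 0]) (use True PInf in auto)
  next
    case False
    then have r: "0 < r" using assms by simp
    show ?thesis
    proof (rule that[of "ln r + w"])
      fix x assume "\<bar>x - (ln r + w)\<bar> < w"
      then have "ln r < x" by auto
      then have "exp (ln r) < exp x" by simp
      then show "r < exp x \<and> ereal (exp x) < R" using r PInf by simp
    qed
  qed
qed (use assms in auto)

lemma open_annulus: "open (annulus r R)"
proof -
  have "annulus r R = {z :: complex. r < cmod z} \<inter> {z. ereal (cmod z) < R}" by (auto simp: annulus_def)
  moreover have "open {z :: complex. r < cmod z}" by (intro open_Collect_less continuous_intros)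
  moreover have "open {z :: complex. ereal (cmod z) < R}"
    by (intro open_Collect_less continuous_intros)
  ultimately show ?thesis by (simp only: open_Int)
qed

lemma convex_log_annulus: "convex {s. exp s \<in> annulus r R}"
proof -
  let ?I = "{x. r < exp x \<and> ereal (exp x) < R}"
  have "is_interval ?I"
    unfolding is_interval_1
  proof (intro ballI allI impI)
    fix a b x assume a: "a \<in> ?I" and b: "b \<in> ?I" and x: "a \<le> x \<and> x \<le> b"
    have "exp a \<le> exp x" "exp x \<le> exp b" using x by auto
    moreover have "r < exp a" using a by simp
    ultimately have "r < exp x" "ereal (exp x) \<le> ereal (exp b)" by (linarith, simp)
    moreover have "ereal (exp b) < R" using b by simp
    ultimately show "x \<in> ?I" using le_less_trans by blast
  qed
  then have "convex (Re -` ?I)"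
    by (intro convex_linear_vimage) (auto simp: is_interval_convex bounded_linear.linear bounded_linear_Re)
  moreover have "Re -` ?I = {s. exp s \<in> annulus r R}" by (auto simp: annulus_def)
  ultimately show ?thesis by simp
qed

theorem theorem1:
  fixes n :: nat and r :: real and R :: ereal and f :: "complex \<Rightarrow> complex poly"
  assumes "prime n"
    and "0 \<le> r" "r < 1" "1 < R"
    and "conformal_module r R > ereal (2 * pi / ln 2 * real n)"
    and "algebroid_function (annulus r R) n f"
    and "separable_on (annulus r R) f"
    and "int n dvd discriminant_index f"
  shows "reducible_on (annulus r R) f"
proof -
  let ?A = "annulus r R"
  define S where "S = {s. exp s \<in> ?A}"
  define F where "F = (\<lambda>s. f (exp s))"
  have n: "0 < n" using assms(1) by (rule prime_gt_0_nat)
  have S_iff: "s \<in> S \<longleftrightarrow> exp s \<in> ?A" for s by (simp add: S_def)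
  have S_open: "open S"
    using open_vimage[OF open_annulus, of exp r R] by (simp add: S_def vimage_def continuous_intros)
  have S_convex: "convex S" unfolding S_def by (rule convex_log_annulus)
  have "0 \<in> S" using assms by (simp add: S_def annulus_def one_ereal_def)
  have q: "quasipolynomial ?A n f" using assms by (simp add: algebroid_function_def)
  have Fq: "quasipolynomial S n F"
    unfolding quasipolynomial_def
  proof (intro conjI ballI allI impI)
    show "degree (F s) = n" "lead_coeff (F s) = 1" if "s \<in> S" for s
      using q that by (auto simp: quasipolynomial_def S_iff F_def)
    show "continuous_on S (\<lambda>s. coeff (F s) j)" if "j < n" for j
      unfolding F_def
      by (rule continuous_on_compose2[OF quasipolynomial_coeff_continuous[OF q]])
         (auto intro!: continuous_intros simp: S_iff)
  qed
  have Fs: "separable_on S F" using assms(7) by (auto simp: separable_on_def S_iff F_def)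
  have F_hol: "(\<lambda>s. coeff (F s) j) holomorphic_on S" if "j < n" for j
  proof -
    have "(\<lambda>x. coeff (f x) j) holomorphic_on ?A" using assms(6) that by (simp add: algebroid_function_def)
    then show ?thesis
      unfolding F_def
      by (rule holomorphic_on_compose_gen[of exp S "\<lambda>x. coeff (f x) j" ?A, unfolded o_def, rotated])
         (auto intro!: holomorphic_intros simp: S_iff)
  qed
  have sq0: "rsquarefree (F 0)" "lead_coeff (F 0) = 1" "degree (F 0) = n"
    using Fq Fs \<open>0 \<in> S\<close> by (auto simp: quasipolynomial_def separable_on_def)
  have "card {z. poly (F 0) z = 0} \<noteq> 0" using monic_squarefree_roots(2)[OF sq0(1,2)] sq0(3) n by simp
  then obtain z where "poly (F 0) z = 0" by fastforce
  then obtain P where P: "continuous_on S P" "\<And>s. s \<in> S \<Longrightarrow> poly (F s) (P s) = 0"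
    using root_lift[OF Fq Fs n S_convex \<open>0 \<in> S\<close>] by metis
  have shift: "s + turn k \<in> S" if "s \<in> S" for s k using that by (simp add: S_iff)
  have per: "F (s + turn k) = F s" for s k by (simp add: F_def)
  obtain m where m: "0 < m" "m \<le> n"
    and iff: "\<And>s i j. s \<in> S \<Longrightarrow> P (s + turn i) = P (s + turn j) \<longleftrightarrow> [i = j] (mod int m)"
    using root_period[OF Fq Fs n convex_connected[OF S_convex] \<open>0 \<in> S\<close> shift per P] by metis
  show ?thesis
  proof (cases "m < n")
    case True
    show ?thesis
      by (rule reducible_if_short_period[OF S_open S_iff _ q assms(7) P(1) _ m(1) True iff])
         (use P(2) assms(2) in \<open>auto simp: F_def annulus_def\<close>)
  next
    case False
    then have "m = n" using m by simp
    define w where "w = 2 * pi\<^sup>2 * n / ln 2"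
    have "0 < w" using n by (simp add: w_def)
    moreover have "ereal (w / pi) = ereal (2 * pi / ln 2 * real n)" by (simp add: w_def power2_eq_square)
    ultimately obtain x0 where x0: "\<And>x. \<bar>x - x0\<bar> < w \<Longrightarrow> r < exp x \<and> ereal (exp x) < R"
      using annulus_strip[OF assms(2-4), of w] assms(5) by metis
    interpret cyclic_roots S P n x0
    proof
      show "prime n" by fact
      show "convex S" "open S" by fact+
      show "t \<in> S" if "s \<in> S" "Re s = Re t" for s t
        using that by (simp add: S_iff annulus_def)
      show "s \<in> S" if "\<bar>Re s - x0\<bar> < 2 * pi\<^sup>2 * real n / ln 2" for s
        using x0[of "Re s"] that by (simp add: w_def S_iff annulus_def)
      show "P holomorphic_on S" by (rule root_holomorphic[OF Fq Fs F_hol S_open P])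
      show "P (s + turn i) = P (s + turn j) \<longleftrightarrow> [i = j] (mod int n)" if "s \<in> S" for s i j
        using iff[OF that] \<open>m = n\<close> by simp
    qed
    have "f (exp s) = (\<Prod>j<n. [:- P (s + turn (int j)), 1:])" if s: "s \<in> S" for s
    proof -
      have sq: "rsquarefree (F s)" "lead_coeff (F s) = 1" "degree (F s) = n"
        using Fq Fs s by (auto simp: quasipolynomial_def separable_on_def)
      note R = monic_squarefree_roots[OF sq(1,2)]
      have inj: "inj_on (\<lambda>j. P (s + turn (int j))) {..<n}"
        using P_eq_iff[OF s] by (intro inj_onI) (auto simp: cong_def)
      have img: "(\<lambda>j. P (s + turn (int j))) ` {..<n} = {z. poly (F s) z = 0}"
      proof (rule card_subset_eq[OF R(3)])
        show "(\<lambda>j. P (s + turn (int j))) ` {..<n} \<subseteq> {z. poly (F s) z = 0}"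
          using P(2)[OF shift[OF s]] per by auto
        show "card ((\<lambda>j. P (s + turn (int j))) ` {..<n}) = card {z. poly (F s) z = 0}"
          using card_image[OF inj] R(2) sq(3) by simp
      qed
      have "(\<Prod>j<n. [:- P (s + turn (int j)), 1:]) = (\<Prod>z\<in>(\<lambda>j. P (s + turn (int j))) ` {..<n}. [:- z, 1:])"
        by (simp add: prod.reindex[OF inj])
      also have "\<dots> = F s" unfolding img using R(1) by simp
      finally show ?thesis by (simp add: F_def)
    qed
    then have "\<not> int n dvd discriminant_index f"
      using discriminant_index_not_divisible[OF \<open>0 \<in> S\<close>] by blast
    with assms(8) show ?thesis by simp
  qed
qed

end
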